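(* Let $\psi\in(\mathfrak{n}^+/[\mathfrak{n}^+,\mathfrak{n}^+])^*$ with $\psi(d_2)\neq 0$ and let $\xi\in\mathbb{C}$. Let $N$ be a finite-dimensional $(\mathbb{C}z\oplus\mathfrak{n}^+)$-module on which $z$ acts by $\xi$, with a basis $v_1,\ldots,v_n$ on which $\mathfrak{n}^+$ acts by $$x v_j=\psi(x)v_j+\sum_{i<j}\alpha(i,j)(x)\,v_i\qquad (x\in\mathfrak{n}^+,\ 1\le j\le n),$$ where $\alpha(i,j)\in(\mathfrak{n}^+)^*$ for $1\le i<j\le n$. Let $V_N=U(\mathfrak{g})\otimes_{U(\mathbb{C}z\oplus\mathfrak{n}^+)}N$. Assume that $\alpha(i,i+1)\notin\mathbb{C}\,D\psi$ for $1\le i\le n-1$, where $D\psi\in(\mathfrak{n}^+)^*$ is the functional $D\psi(d_k)=k\,\psi(d_k)$ for $k>0$. Then $\mathrm{Wh}_\psi(V_N)=\mathbb{C}v_1$.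
   Context: $\mathfrak{g}$ is the Virasoro Lie algebra over $\mathbb{C}$, with basis $\{z, d_k \mid k \in \mathbb{Z}\}$ and bracket $[d_k,d_j]=(k-j)d_{k+j}+\delta_{j,-k}\frac{k^3-k}{12}z$, $[z,d_k]=0$; $\mathfrak{n}^+=\mathrm{span}_{\mathbb{C}}\{d_k \mid k>0\}$. Elements of $(\mathfrak{n}^+/[\mathfrak{n}^+,\mathfrak{n}^+])^*$ are identified with Lie algebra homomorphisms $\mathfrak{n}^+\to\mathbb{C}$. For a $\mathfrak{g}$-module $V$, $\mathrm{Wh}_\psi(V)=\{w\in V \mid xw=\psi(x)w \text{ for all } x\in\mathfrak{n}^+\}$. $N$ is identified with the subspace $1\otimes N$ of $V_N$. *)

theory Defs
  imports Complex_Main "HOL-Library.Poly_Mapping"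
begin

section \<open>Complex vector spaces, Lie algebras and their modules\<close>

class complex_vec = ab_group_add +
  fixes cscale :: "complex \<Rightarrow> 'a \<Rightarrow> 'a"  (infixr "*\<^sub>C" 75)
  assumes cscale_add_right: "c *\<^sub>C (x + y) = c *\<^sub>C x + c *\<^sub>C y"
    and cscale_add_left: "(c + d) *\<^sub>C x = c *\<^sub>C x + d *\<^sub>C x"
    and cscale_cscale: "c *\<^sub>C (d *\<^sub>C x) = (c * d) *\<^sub>C x"
    and cscale_one [simp]: "1 *\<^sub>C x = x"

global_interpretation cvec: vector_space "cscale :: complex \<Rightarrow> 'a \<Rightarrow> 'a::complex_vec"
  by unfold_locales
    (simp_all add: cscale_add_right cscale_add_left cscale_cscale)

class lie_algebra = complex_vec +
  fixes bracket :: "'a \<Rightarrow> 'a \<Rightarrow> 'a"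
  assumes bracket_add_left: "bracket (x + y) w = bracket x w + bracket y w"
    and bracket_add_right: "bracket w (x + y) = bracket w x + bracket w y"
    and bracket_cscale_left: "bracket (c *\<^sub>C x) y = c *\<^sub>C bracket x y"
    and bracket_cscale_right: "bracket x (c *\<^sub>C y) = c *\<^sub>C bracket x y"
    and bracket_self: "bracket x x = 0"
    and jacobi: "bracket x (bracket y w) + bracket y (bracket w x) + bracket w (bracket x y) = 0"

locale lie_module =
  fixes act :: "'g::lie_algebra \<Rightarrow> 'v::complex_vec \<Rightarrow> 'v"
  assumes act_add_left: "act (x + y) v = act x v + act y v"
    and act_add_right: "act x (v + w) = act x v + act x w"
    and act_cscale_left: "act (c *\<^sub>C x) v = c *\<^sub>C act x v"
    and act_cscale_right: "act x (c *\<^sub>C v) = c *\<^sub>C act x v"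
    and act_bracket: "act (bracket x y) v = act x (act y v) - act y (act x v)"


section \<open>Linear extension\<close>

definition lin_ext :: "('k \<Rightarrow> 'v::complex_vec) \<Rightarrow> ('k \<Rightarrow>\<^sub>0 complex) \<Rightarrow> 'v" where
  "lin_ext f a = (\<Sum>k\<in>Poly_Mapping.keys a. Poly_Mapping.lookup a k *\<^sub>C f k)"

lemma lin_ext_superset:
  "finite A \<Longrightarrow> Poly_Mapping.keys a \<subseteq> A \<Longrightarrow>
    lin_ext f a = (\<Sum>k\<in>A. Poly_Mapping.lookup a k *\<^sub>C f k)"
  unfolding lin_ext_def by (rule sum.mono_neutral_left) (auto simp: in_keys_iff)

lemma lin_ext_0 [simp]: "lin_ext f 0 = 0"
  by (simp add: lin_ext_def)

lemma lin_ext_single [simp]: "lin_ext f (Poly_Mapping.single k c) = c *\<^sub>C f k"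
  by (simp add: lin_ext_def)

lemma lin_ext_add: "lin_ext f (a + b) = lin_ext f a + lin_ext f b"
proof -
  let ?A = "Poly_Mapping.keys a \<union> Poly_Mapping.keys b"
  have "Poly_Mapping.keys (a + b) \<subseteq> ?A" by (rule Poly_Mapping.keys_add)
  then show ?thesis
    by (simp add: lin_ext_superset[of ?A] lookup_add cscale_add_left sum.distrib)
qed

lemma lin_ext_uminus: "lin_ext f (- a) = - lin_ext f a"
  using lin_ext_add[of f a "- a"] by (simp add: eq_neg_iff_add_eq_0 add.commute)

lemma lin_ext_diff: "lin_ext f (a - b) = lin_ext f a - lin_ext f b"
  using lin_ext_add[of f a "- b"] by (simp add: lin_ext_uminus)

lemma lookup_map_scale:
  "Poly_Mapping.lookup (Poly_Mapping.map ((*) c) a) k = (c::complex) * Poly_Mapping.lookup a k"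
  by (transfer) (auto simp: when_def)

lemma lin_ext_map_scale: "lin_ext f (Poly_Mapping.map ((*) c) a) = c *\<^sub>C lin_ext f a"
proof -
  have "Poly_Mapping.keys (Poly_Mapping.map ((*) c) a) \<subseteq> Poly_Mapping.keys a"
    by (auto simp: in_keys_iff lookup_map_scale)
  then show ?thesis
    by (simp add: lin_ext_superset[of "Poly_Mapping.keys a"] lookup_map_scale cvec.scale_sum_right)
qed

lemma lin_ext_fun_add: "lin_ext (\<lambda>k. f k + g k) a = lin_ext f a + lin_ext g a"
  by (simp add: lin_ext_def cscale_add_right sum.distrib)

lemma lin_ext_fun_scale: "lin_ext (\<lambda>k. c *\<^sub>C f k) a = c *\<^sub>C lin_ext f a"
  by (simp add: lin_ext_def cvec.scale_sum_right mult.commute)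

lemma poly_mapping_add_induct [case_names single add]:
  assumes single: "\<And>k c. P (Poly_Mapping.single k c)"
    and add: "\<And>a b. P a \<Longrightarrow> P b \<Longrightarrow> P (a + b)"
  shows "P (a :: 'k \<Rightarrow>\<^sub>0 'c::comm_monoid_add)"
proof (induction a rule: update_induct)
  case const
  show ?case using single[of undefined 0] by simp
next
  case (update a k c)
  have "Poly_Mapping.update k c a = a + Poly_Mapping.single k c"
    using update(1)
    by (intro poly_mapping_eqI)
      (auto simp: lookup_update lookup_add lookup_single when_def in_keys_iff)
  then show ?case using single add update by simp
qed


section \<open>The Virasoro algebra\<close>

datatype vir_index = Zi | Di int

typedef virasoro = "UNIV :: (vir_index \<Rightarrow>\<^sub>0 complex) set"
  morphisms vir_coeffs Vir by simp

setup_lifting type_definition_virasoro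

instantiation virasoro :: complex_vec
begin
lift_definition zero_virasoro :: virasoro is 0 .
lift_definition plus_virasoro :: "virasoro \<Rightarrow> virasoro \<Rightarrow> virasoro" is "(+)" .
lift_definition minus_virasoro :: "virasoro \<Rightarrow> virasoro \<Rightarrow> virasoro" is "(-)" .
lift_definition uminus_virasoro :: "virasoro \<Rightarrow> virasoro" is "uminus" .
lift_definition cscale_virasoro :: "complex \<Rightarrow> virasoro \<Rightarrow> virasoro"
  is "\<lambda>c. Poly_Mapping.map ((*) c)" .
instance
  by standard
    (transfer, auto intro!: poly_mapping_eqI
      simp: lookup_map_scale lookup_add algebra_simps)+
end

definition vir_z :: virasoro where "vir_z = Vir (Poly_Mapping.single Zi 1)"

definition vir_d :: "int \<Rightarrow> virasoro" where "vir_d k = Vir (Poly_Mapping.single (Di k) 1)"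

fun vir_basis_bracket :: "vir_index \<Rightarrow> vir_index \<Rightarrow> virasoro" where
  "vir_basis_bracket (Di k) (Di j) =
     of_int (k - j) *\<^sub>C vir_d (k + j)
     + (if j = - k then (of_int (k ^ 3 - k) / 12) *\<^sub>C vir_z else 0)"
| "vir_basis_bracket _ _ = 0"

fun vir_basis :: "vir_index \<Rightarrow> virasoro" where
  "vir_basis Zi = vir_z"
| "vir_basis (Di k) = vir_d k"

lemma vir_coeffs_add: "vir_coeffs (x + y) = vir_coeffs x + vir_coeffs y"
  by (rule plus_virasoro.rep_eq)

lemma vir_coeffs_cscale: "vir_coeffs (c *\<^sub>C x) = Poly_Mapping.map ((*) c) (vir_coeffs x)"
  by (rule cscale_virasoro.rep_eq)

lemma vir_coeffs_z [simp]: "vir_coeffs vir_z = Poly_Mapping.single Zi 1"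
  and vir_coeffs_d [simp]: "vir_coeffs (vir_d k) = Poly_Mapping.single (Di k) 1"
  by (simp_all add: vir_z_def vir_d_def Vir_inverse)

lemma vir_coeffs_basis [simp]: "vir_coeffs (vir_basis i) = Poly_Mapping.single i 1"
  by (cases i) auto

lemma Vir_single: "Vir (Poly_Mapping.single i c) = c *\<^sub>C vir_basis i"
proof -
  have "vir_coeffs (Vir (Poly_Mapping.single i c)) = vir_coeffs (c *\<^sub>C vir_basis i)"
    by (intro poly_mapping_eqI)
      (simp add: Vir_inverse vir_coeffs_cscale lookup_map_scale lookup_single when_def)
  then show ?thesis by (simp only: vir_coeffs_inject)
qed

lemma vir_induct [case_names basis scale add]:
  assumes "\<And>i. P (vir_basis i)" and scale: "\<And>c x. P x \<Longrightarrow> P (c *\<^sub>C x)"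
    and add: "\<And>x y. P x \<Longrightarrow> P y \<Longrightarrow> P (x + y)"
  shows "P x"
proof -
  have "P (Vir a)" for a
  proof (induction a rule: poly_mapping_add_induct)
    case (single k c)
    show ?case unfolding Vir_single using assms by blast
  next
    case (add a b)
    have "Vir (a + b) = Vir a + Vir b"
      by (simp add: plus_virasoro_def Vir_inverse)
    then show ?case using add assms(3) by simp
  qed
  then show ?thesis by (metis vir_coeffs_inverse)
qed

instantiation virasoro :: lie_algebra
begin

definition bracket_virasoro :: "virasoro \<Rightarrow> virasoro \<Rightarrow> virasoro" where
  "bracket_virasoro x y =
     lin_ext (\<lambda>i. lin_ext (\<lambda>j. vir_basis_bracket i j) (vir_coeffs y)) (vir_coeffs x)"

instance
proof
  fix x y w :: virasoro and c :: complex
  show addl: "bracket (x + y) w = bracket x w + bracket y w" for x y w :: virasoro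
    by (simp add: bracket_virasoro_def vir_coeffs_add lin_ext_add)
  show addr: "bracket w (x + y) = bracket w x + bracket w y" for x y w :: virasoro
    by (simp add: bracket_virasoro_def vir_coeffs_add lin_ext_add lin_ext_fun_add)
  show scl: "bracket (c *\<^sub>C x) y = c *\<^sub>C bracket x y" for c and x y :: virasoro
    by (simp add: bracket_virasoro_def vir_coeffs_cscale lin_ext_map_scale)
  show scr: "bracket x (c *\<^sub>C y) = c *\<^sub>C bracket x y" for c and x y :: virasoro
    by (simp add: bracket_virasoro_def vir_coeffs_cscale lin_ext_map_scale lin_ext_fun_scale)
  have bas: "bracket (vir_basis i) (vir_basis j) = vir_basis_bracket i j" for i j
    by (simp add: bracket_virasoro_def)
  have basdd: "bracket (vir_d k) (vir_d j) = vir_basis_bracket (Di k) (Di j)" for k j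
    using bas[of "Di k" "Di j"] by simp
  have basz: "bracket vir_z (vir_basis j) = 0" "bracket (vir_basis j) vir_z = 0" for j
    using bas[of "Zi" j] bas[of j Zi] by simp_all
  have zero: "bracket vir_z x = 0" "bracket x vir_z = 0" for x
    by (induction x rule: vir_induct) (simp_all add: basz addl addr scl scr)
  define T :: "int \<Rightarrow> int \<Rightarrow> complex"
    where "T k l = (if l = - k then of_int (k ^ 3 - k) / 12 else 0)" for k l
  have dd: "bracket (vir_d k) (vir_d l) = of_int (k - l) *\<^sub>C vir_d (k + l) + T k l *\<^sub>C vir_z"
    for k l by (simp add: basdd T_def)
  have comb: "(a *\<^sub>C u + b *\<^sub>C v) + (a' *\<^sub>C u + b' *\<^sub>C v) = (a + a') *\<^sub>C u + (b + b') *\<^sub>C v"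
    for a b a' b' and u v :: virasoro
    by (simp only: cscale_add_left ac_simps)
  have Tsw: "T k l + T l k = 0" for k l
    by (auto simp: T_def field_simps)
  have anti_bas: "bracket (vir_basis i) (vir_basis j) + bracket (vir_basis j) (vir_basis i) = 0"
    for i j
  proof (cases i; cases j)
    fix k l assume ij: "i = Di k" "j = Di l"
    have "bracket (vir_d l) (vir_d k) = of_int (l - k) *\<^sub>C vir_d (k + l) + T l k *\<^sub>C vir_z"
      by (simp only: dd add.commute)
    then show ?thesis
      unfolding ij vir_basis.simps dd[of k l] by (simp only: comb Tsw) simp
  qed (auto simp: zero)
  have z2: "(a + b) + (a' + b') = 0" if "a + a' = 0" "b + b' = 0" for a b a' b' :: virasoro
    using that by (simp add: add_eq_0_iff)
  have zs: "a *\<^sub>C u + a *\<^sub>C v = 0" if "u + v = 0" for a and u v :: virasoro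
    using that by (metis cscale_add_right cvec.scale_zero_right)
  have anti1: "bracket (vir_basis i) y + bracket y (vir_basis i) = 0" for i y
  proof (induction y rule: vir_induct)
    case (basis j) show ?case by (rule anti_bas)
  next
    case (scale c y) then show ?case unfolding scl scr by (rule zs)
  next
    case (add x y) then show ?case unfolding addl addr by (rule z2)
  qed
  have anti: "bracket x y + bracket y x = 0" for x y :: virasoro
  proof (induction x rule: vir_induct)
    case (basis j) show ?case by (rule anti1)
  next
    case (scale c y) then show ?case unfolding scl scr by (rule zs)
  next
    case (add x y) then show ?case unfolding addl addr by (rule z2)
  qed
  show "bracket x x = 0"
  proof -
    have "2 *\<^sub>C bracket x x = 0"
      using anti[of x x] cscale_add_left[of 1 1 "bracket x x"] by simp
    then show ?thesis by simp
  qed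
  let ?J = "\<lambda>x y w::virasoro. bracket x (bracket y w) + bracket y (bracket w x) + bracket w (bracket x y)"
  have ddd: "bracket (vir_d k) (bracket (vir_d l) (vir_d m)) =
      of_int ((l - m) * (k - l - m)) *\<^sub>C vir_d n + (of_int (l - m) * T k (l + m)) *\<^sub>C vir_z"
    if n: "n = k + l + m" for k l m n
  proof -
    have "bracket (vir_d k) (bracket (vir_d l) (vir_d m)) =
        of_int (l - m) *\<^sub>C bracket (vir_d k) (vir_d (l + m))"
      by (simp only: dd[of l m] addr scr zero) simp
    also have "\<dots> = (of_int (l - m) * of_int (k - (l + m))) *\<^sub>C vir_d (k + (l + m))
        + (of_int (l - m) * T k (l + m)) *\<^sub>C vir_z"
      by (simp only: dd[of k "l + m"] cscale_add_right cscale_cscale)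
    finally show ?thesis by (simp add: n add.assoc diff_diff_eq)
  qed
  have TJ: "of_int (l - m) * T k (l + m) + of_int (m - k) * T l (m + k)
      + of_int (k - l) * T m (k + l) = 0" for k l m
  proof (cases "m = - k - l")
    case True
    then show ?thesis
      by (simp add: T_def) (simp add: field_simps power3_eq_cube)
  next
    case False
    then have "l + m \<noteq> - k" "m + k \<noteq> - l" "k + l \<noteq> - m" by auto
    then show ?thesis by (simp add: T_def)
  qed
  have dJ: "of_int ((l - m) * (k - l - m)) + of_int ((m - k) * (l - m - k))
      + of_int ((k - l) * (m - k - l)) = (0::complex)" for k l m :: int
    by (simp add: algebra_simps)
  have Jd: "?J (vir_d k) (vir_d l) (vir_d m) = 0" for k l m
    by (subst ddd[of "k + l + m" k l m, OF refl], subst ddd[of "k + l + m" l m k], simp,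
        subst ddd[of "k + l + m" m k l], simp) (simp only: comb dJ TJ, simp)
  have br0: "bracket x 0 = 0" "bracket 0 x = 0" for x :: virasoro
    using scr[of x 0 0] scl[of 0 0 x] by simp_all
  have Jb: "?J (vir_basis i) (vir_basis j) (vir_basis k) = 0" for i j k
    by (cases i; cases j; cases k) (simp_all add: zero br0 Jd)
  have re: "a + a' + (b + b') + (c + c') = (a + b + c) + (a' + b' + c')"
    for a b c a' b' c' :: virasoro by (simp add: algebra_simps)
  have J3: "?J (c *\<^sub>C x) y w = c *\<^sub>C ?J x y w" "?J (x + x') y w = ?J x y w + ?J x' y w" for c x x' y w
    unfolding addl addr scl scr cscale_add_right by (rule refl, rule re)
  have Jcyc: "?J x y w = ?J y w x" for x y w :: virasoro
    by (simp only: add.assoc add.commute[of "bracket x (bracket y w)"])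
  have J1: "?J w (vir_basis i) (vir_basis j) = 0" for i j w
  proof (induction w rule: vir_induct)
    case (basis k) show ?case by (rule Jb)
  next
    case (scale c x) then show ?case unfolding J3 by (simp only: cvec.scale_zero_right)
  next
    case (add x y) then show ?case unfolding J3 by (simp only: add_0)
  qed
  have J2: "?J y w (vir_basis i) = 0" for i y w
  proof (induction y rule: vir_induct)
    case (basis j)
    show ?case by (rule trans[OF Jcyc J1])
  next
    case (scale c x) then show ?case unfolding J3 by (simp only: cvec.scale_zero_right)
  next
    case (add x y) then show ?case unfolding J3 by (simp only: add_0)
  qed
  show "?J x y w = 0"
  proof (induction x rule: vir_induct)
    case (basis j)
    show ?case by (rule trans[OF Jcyc J2])
  next
    case (scale c x) then show ?case unfolding J3 by (simp only: cvec.scale_zero_right)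
  next
    case (add x y) then show ?case unfolding J3 by (simp only: add_0)
  qed
qed

end


section \<open>The universal enveloping algebra\<close>

text \<open>
  The free associative algebra on the set underlying \<open>'g\<close> is the monoid algebra of
  words over \<open>'g\<close>. Imposing linearity of the generators turns it into the tensor algebra
  of the vector space \<open>'g\<close>; imposing in addition \<open>x y - y x = [x, y]\<close> gives
  the enveloping algebra.
\<close>

datatype 'g word = Word (letters: "'g list")

instantiation word :: (type) monoid_add
begin
definition "0 = Word []"
definition "v + w = Word (letters v @ letters w)"
instance by standard (simp_all add: zero_word_def plus_word_def)
end

type_synonym 'g free_alg = "'g word \<Rightarrow>\<^sub>0 complex"

definition fa_const :: "complex \<Rightarrow> 'g free_alg" where
  "fa_const c = Poly_Mapping.single 0 c"

definition fa_gen :: "'g \<Rightarrow> 'g free_alg" where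
  "fa_gen x = Poly_Mapping.single (Word [x]) 1"

inductive_set uea_ideal :: "'g::lie_algebra free_alg set" where
  gen_add: "fa_gen (x + y) - fa_gen x - fa_gen y \<in> uea_ideal"
| gen_cscale: "fa_gen (c *\<^sub>C x) - fa_const c * fa_gen x \<in> uea_ideal"
| gen_bracket: "fa_gen x * fa_gen y - fa_gen y * fa_gen x - fa_gen (bracket x y) \<in> uea_ideal"
| diff: "a \<in> uea_ideal \<Longrightarrow> b \<in> uea_ideal \<Longrightarrow> a - b \<in> uea_ideal"
| mult_left: "a \<in> uea_ideal \<Longrightarrow> b * a \<in> uea_ideal"
| mult_right: "a \<in> uea_ideal \<Longrightarrow> a * b \<in> uea_ideal"

lemma uea_ideal_0: "0 \<in> uea_ideal"
  using uea_ideal.mult_left[OF uea_ideal.gen_add, of 0] by simp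

lemma uea_ideal_uminus: "a \<in> uea_ideal \<Longrightarrow> - a \<in> uea_ideal"
  using uea_ideal.diff[OF uea_ideal_0] by fastforce

lemma uea_ideal_add: "a \<in> uea_ideal \<Longrightarrow> b \<in> uea_ideal \<Longrightarrow> a + b \<in> uea_ideal"
  using uea_ideal.diff[OF _ uea_ideal_uminus, of a b] by simp

quotient_type (overloaded) 'g uea = "'g::lie_algebra free_alg" / "\<lambda>a b. a - b \<in> uea_ideal"
proof (rule equivpI)
  show "reflp (\<lambda>a b :: 'g free_alg. a - b \<in> uea_ideal)"
    by (simp add: reflp_def uea_ideal_0)
  show "symp (\<lambda>a b :: 'g free_alg. a - b \<in> uea_ideal)"
    by (rule sympI) (use uea_ideal_uminus in fastforce)
  show "transp (\<lambda>a b :: 'g free_alg. a - b \<in> uea_ideal)"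
    by (rule transpI) (use uea_ideal_add in fastforce)
qed

text \<open>
  The associative action of the free algebra, and then of the enveloping algebra, on a module
  of the Lie algebra: a word acts by the composition of its letters.
\<close>

definition fa_act :: "('g \<Rightarrow> 'v \<Rightarrow> 'v) \<Rightarrow> 'g free_alg \<Rightarrow> 'v::complex_vec \<Rightarrow> 'v" where
  "fa_act act a v = lin_ext (\<lambda>w. foldr act (letters w) v) a"

definition uea_act :: "('g::lie_algebra \<Rightarrow> 'v \<Rightarrow> 'v) \<Rightarrow> 'g uea \<Rightarrow> 'v::complex_vec \<Rightarrow> 'v" where
  "uea_act act u v = fa_act act (rep_uea u) v"

context lie_module
begin

lemma foldr_act_add: "foldr act xs (v + w) = foldr act xs v + foldr act xs w"
  by (induction xs) (simp_all add: act_add_right)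

lemma foldr_act_cscale: "foldr act xs (c *\<^sub>C v) = c *\<^sub>C foldr act xs v"
  by (induction xs) (simp_all add: act_cscale_right)

lemma fa_act_add_right: "fa_act act a (v + w) = fa_act act a v + fa_act act a w"
  by (simp add: fa_act_def foldr_act_add lin_ext_fun_add)

lemma fa_act_cscale_right: "fa_act act a (c *\<^sub>C v) = c *\<^sub>C fa_act act a v"
  by (simp add: fa_act_def foldr_act_cscale lin_ext_fun_scale)

lemma fa_act_add_left: "fa_act act (a + b) v = fa_act act a v + fa_act act b v"
  by (simp add: fa_act_def lin_ext_add)

lemma fa_act_diff_left: "fa_act act (a - b) v = fa_act act a v - fa_act act b v"
  by (simp add: fa_act_def lin_ext_diff)

lemma fa_act_zero_right: "fa_act act a 0 = 0"
  using fa_act_cscale_right[of a 0 0] by simp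

lemma fa_act_const: "fa_act act (fa_const c) v = c *\<^sub>C v"
  by (simp add: fa_act_def fa_const_def zero_word_def)

lemma fa_act_gen: "fa_act act (fa_gen x) v = act x v"
  by (simp add: fa_act_def fa_gen_def)

lemma fa_act_mult: "fa_act act (a * b) v = fa_act act a (fa_act act b v)"
proof (induction a rule: poly_mapping_add_induct)
  case (single k c)
  show ?case
  proof (induction b rule: poly_mapping_add_induct)
    case (single l d)
    show ?case
      by (simp add: fa_act_def mult_single plus_word_def foldr_act_cscale cscale_cscale)
  next
    case (add a b)
    then show ?case by (simp add: distrib_left fa_act_add_left fa_act_add_right)
  qed
next
  case (add a b)
  then show ?case by (simp add: distrib_right fa_act_add_left)
qed

lemma fa_act_ideal: "a \<in> uea_ideal \<Longrightarrow> fa_act act a v = 0"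
proof (induction a arbitrary: v rule: uea_ideal.induct)
qed (simp_all add: fa_act_diff_left fa_act_mult fa_act_gen fa_act_const fa_act_zero_right
    act_add_left act_cscale_left act_bracket)

lemma uea_act_abs: "uea_act act (abs_uea a) v = fa_act act a v"
proof -
  have "rep_uea (abs_uea a) - a \<in> uea_ideal"
    using Quotient3_rep_abs[OF Quotient3_uea] uea_ideal_0
    by (metis (mono_tags) cancel_comm_monoid_add_class.diff_cancel)
  from fa_act_ideal[OF this] show ?thesis
    by (simp add: uea_act_def fa_act_diff_left)
qed

end

instantiation complex :: complex_vec
begin
definition cscale_complex :: "complex \<Rightarrow> complex \<Rightarrow> complex" where "cscale_complex = (*)"
instance by standard (simp_all add: cscale_complex_def algebra_simps)
end

lemma one_notin_uea_ideal: "(1 :: 'g::lie_algebra free_alg) \<notin> uea_ideal"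
proof
  interpret lie_module "\<lambda>(x::'g) (v::complex). 0"
    by standard simp_all
  assume "(1 :: 'g free_alg) \<in> uea_ideal"
  moreover have "(1 :: 'g free_alg) = fa_const 1" by (simp add: fa_const_def)
  ultimately have "fa_act (\<lambda>(x::'g) (v::complex). 0) (fa_const 1) 1 = 0"
    using fa_act_ideal by metis
  then show False by (simp add: fa_act_const)
qed

instantiation uea :: (lie_algebra) ring_1
begin
lift_definition zero_uea :: "'a uea" is 0 .
lift_definition one_uea :: "'a uea" is 1 .
lift_definition plus_uea :: "'a uea \<Rightarrow> 'a uea \<Rightarrow> 'a uea" is "(+)"
  by (metis add_diff_add uea_ideal_add)
lift_definition uminus_uea :: "'a uea \<Rightarrow> 'a uea" is "uminus"
  by (metis minus_diff_minus uea_ideal_uminus)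
lift_definition minus_uea :: "'a uea \<Rightarrow> 'a uea \<Rightarrow> 'a uea" is "(-)"
proof -
  fix a b c d :: "'a free_alg"
  assume "a - b \<in> uea_ideal" "c - d \<in> uea_ideal"
  from uea_ideal.diff[OF this] show "a - c - (b - d) \<in> uea_ideal" by (simp add: algebra_simps)
qed
lift_definition times_uea :: "'a uea \<Rightarrow> 'a uea \<Rightarrow> 'a uea" is "(*)"
proof -
  fix a b c d :: "'a free_alg"
  assume "a - b \<in> uea_ideal" "c - d \<in> uea_ideal"
  then have "(a - b) * c + b * (c - d) \<in> uea_ideal"
    by (intro uea_ideal_add uea_ideal.mult_left uea_ideal.mult_right)
  then show "a * c - b * d \<in> uea_ideal" by (simp add: algebra_simps)
qed
instance
proof
  show "(0 :: 'a uea) \<noteq> 1"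
    by transfer (use one_notin_uea_ideal uea_ideal_uminus in fastforce)
qed (transfer, simp add: algebra_simps uea_ideal_0)+
end

lift_definition uea_const :: "complex \<Rightarrow> 'g::lie_algebra uea" is fa_const .

lift_definition uea_gen :: "'g::lie_algebra \<Rightarrow> 'g uea" is fa_gen .

lemma uea_const_add: "uea_const (c + d) = uea_const c + uea_const d"
  by transfer (simp add: fa_const_def single_add uea_ideal_0)

lemma uea_const_mult: "uea_const (c * d) = uea_const c * uea_const d"
  by transfer (simp add: fa_const_def mult_single uea_ideal_0)

lemma uea_const_1 [simp]: "uea_const 1 = 1"
  by transfer (simp add: fa_const_def uea_ideal_0)

lemma fa_const_central: "fa_const c * a = a * fa_const c"
proof (induction a rule: poly_mapping_add_induct)
  case (single k d)
  show ?case by (simp add: fa_const_def mult_single mult.commute)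
qed (simp add: algebra_simps)

lemma uea_const_central: "uea_const c * u = u * uea_const c"
  by transfer (simp add: fa_const_central uea_ideal_0)

instantiation uea :: (lie_algebra) complex_vec
begin
definition cscale_uea :: "complex \<Rightarrow> 'a uea \<Rightarrow> 'a uea" where "cscale_uea c u = uea_const c * u"
instance
  by standard (simp_all add: cscale_uea_def uea_const_add uea_const_mult algebra_simps)
end

lemma (in lie_module) uea_act_const: "uea_act act (uea_const c) v = c *\<^sub>C v"
  unfolding uea_const.abs_eq uea_act_abs by (rule fa_act_const)

lemma (in lie_module) uea_act_gen: "uea_act act (uea_gen x) v = act x v"
  unfolding uea_gen.abs_eq uea_act_abs by (rule fa_act_gen)

lemma uea_gen_add: "uea_gen (x + y) = uea_gen x + uea_gen y"
  by transfer (use uea_ideal.gen_add in \<open>simp add: diff_diff_eq\<close>)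

lemma uea_gen_cscale: "uea_gen (c *\<^sub>C x) = uea_const c * uea_gen x"
  by transfer (rule uea_ideal.gen_cscale)

lemma uea_gen_bracket: "uea_gen (bracket x y) = uea_gen x * uea_gen y - uea_gen y * uea_gen x"
  by transfer (metis minus_diff_eq uea_ideal.gen_bracket uea_ideal_uminus)


section \<open>The subalgebras \<open>\<complex>z \<oplus> \<nn>\<^sup>+\<close> and \<open>\<nn>\<^sup>+\<close>\<close>

definition nplus :: "virasoro set" where
  "nplus = cvec.span {vir_d k |k. k > 0}"

lemma vir_bracket_basis: "bracket (vir_basis i) (vir_basis j) = vir_basis_bracket i j"
  by (simp add: bracket_virasoro_def)

lemma vir_bracket_dd: "bracket (vir_d k) (vir_d j) = vir_basis_bracket (Di k) (Di j)"
  using vir_bracket_basis[of "Di k" "Di j"] by simp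

lemma vir_bracket_z: "bracket vir_z x = 0" "bracket x vir_z = 0"
proof -
  have "bracket vir_z (vir_basis j) = 0" "bracket (vir_basis j) vir_z = 0" for j
    using vir_bracket_basis[of Zi j] vir_bracket_basis[of j Zi] by simp_all
  then show "bracket vir_z x = 0" "bracket x vir_z = 0"
    by (induction x rule: vir_induct)
      (simp_all add: bracket_add_left bracket_add_right bracket_cscale_left bracket_cscale_right)
qed

definition vir_zn_set :: "virasoro set" where
  "vir_zn_set = cvec.span (insert vir_z {vir_d k |k. k > 0})"

lemma vir_zn_set_bracket:
  assumes "x \<in> vir_zn_set" "y \<in> vir_zn_set"
  shows "bracket x y \<in> vir_zn_set"
proof -
  let ?B = "insert vir_z {vir_d k |k. k > 0}"
  have b0: "bracket 0 w = 0" "bracket w 0 = 0" for w :: virasoro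
    using bracket_cscale_left[of 0 0 w] bracket_cscale_right[of w 0 0] by simp_all
  have gen: "bracket b c \<in> vir_zn_set" if bc: "b \<in> ?B" "c \<in> ?B" for b c
  proof (cases "b = vir_z \<or> c = vir_z")
    case True
    then show ?thesis by (auto simp: vir_bracket_z vir_zn_set_def cvec.span_zero)
  next
    case False
    then obtain k l where kl: "b = vir_d k" "c = vir_d l" "k > 0" "l > 0" using bc by auto
    then have "vir_d (k + l) \<in> ?B" by auto
    then show ?thesis using kl
      by (auto simp: vir_bracket_dd vir_zn_set_def intro: cvec.span_scale cvec.span_base)
  qed
  have "bracket b y \<in> vir_zn_set" if b: "b \<in> ?B" for b
    using assms(2) unfolding vir_zn_set_def
  proof (induction y rule: cvec.span_induct_alt)
    case base then show ?case by (simp add: b0 cvec.span_zero)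
  next
    case (step c x y)
    then show ?case using gen[OF b]
      by (simp add: bracket_add_right bracket_cscale_right cvec.span_add cvec.span_scale vir_zn_set_def)
  qed
  with assms(1) show ?thesis unfolding vir_zn_set_def
  proof (induction x rule: cvec.span_induct_alt)
    case base then show ?case by (simp add: b0 cvec.span_zero)
  next
    case (step c x y)
    then show ?case
      by (simp add: bracket_add_left bracket_cscale_left cvec.span_add cvec.span_scale)
  qed
qed

typedef vir_zn = vir_zn_set morphisms of_zn to_zn
  using cvec.span_zero unfolding vir_zn_set_def by blast

setup_lifting type_definition_vir_zn

lemma vir_z_in_zn: "vir_z \<in> vir_zn_set"
  by (simp add: vir_zn_set_def cvec.span_base)

lemma nplus_subset_zn: "nplus \<subseteq> vir_zn_set"
  unfolding nplus_def vir_zn_set_def by (rule cvec.span_mono) blast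

lemma of_zn_to_zn: "x \<in> vir_zn_set \<Longrightarrow> of_zn (to_zn x) = x"
  by (rule to_zn_inverse)

instantiation vir_zn :: lie_algebra
begin
lift_definition zero_vir_zn :: vir_zn is 0 by (simp add: vir_zn_set_def cvec.span_zero)
lift_definition plus_vir_zn :: "vir_zn \<Rightarrow> vir_zn \<Rightarrow> vir_zn" is "(+)"
  by (simp add: vir_zn_set_def cvec.span_add)
lift_definition minus_vir_zn :: "vir_zn \<Rightarrow> vir_zn \<Rightarrow> vir_zn" is "(-)"
  by (simp add: vir_zn_set_def cvec.span_diff)
lift_definition uminus_vir_zn :: "vir_zn \<Rightarrow> vir_zn" is "uminus"
  by (simp add: vir_zn_set_def cvec.span_neg)
lift_definition cscale_vir_zn :: "complex \<Rightarrow> vir_zn \<Rightarrow> vir_zn" is cscale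
  by (simp add: vir_zn_set_def cvec.span_scale)
lift_definition bracket_vir_zn :: "vir_zn \<Rightarrow> vir_zn \<Rightarrow> vir_zn" is bracket
  by (rule vir_zn_set_bracket)
instance
  by standard
    (transfer, simp add: cscale_add_left cscale_add_right cscale_cscale bracket_add_left
      bracket_add_right bracket_cscale_left bracket_cscale_right bracket_self jacobi)+
end

text \<open>
  The algebra homomorphism \<open>U(\<complex>z \<oplus> \<nn>\<^sup>+) \<rightarrow> U(\<gg>)\<close> induced by the
  inclusion, obtained by letting \<open>\<complex>z \<oplus> \<nn>\<^sup>+\<close> act on \<open>U(\<gg>)\<close> by
  left multiplication and evaluating at \<open>1\<close>.
\<close>

definition uea_incl :: "vir_zn uea \<Rightarrow> virasoro uea" where
  "uea_incl t = uea_act (\<lambda>x u. uea_gen (of_zn x) * u) t 1"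

global_interpretation zn_lmult: lie_module "\<lambda>x u. uea_gen (of_zn x) * u"
proof
  fix x y :: vir_zn and c and u v :: "virasoro uea"
  show "uea_gen (of_zn x) * c *\<^sub>C u = c *\<^sub>C (uea_gen (of_zn x) * u)"
    unfolding cscale_uea_def by (metis mult.assoc uea_const_central)
qed (simp_all add: plus_vir_zn.rep_eq cscale_vir_zn.rep_eq bracket_vir_zn.rep_eq uea_gen_add
    uea_gen_cscale uea_gen_bracket cscale_uea_def algebra_simps)

lemma uea_act_zn_lmult: "uea_act (\<lambda>x u. uea_gen (of_zn x) * u) t v = uea_incl t * v"
proof -
  let ?f = "\<lambda>x u. uea_gen (of_zn x) * u"
  have w: "foldr ?f xs v = foldr ?f xs 1 * v" for xs
    by (induction xs) (simp_all add: mult.assoc)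
  have "fa_act ?f a v = fa_act ?f a 1 * v" for a
    unfolding fa_act_def
  proof (induction a rule: poly_mapping_add_induct)
    case (single k c)
    show ?case using w[of "letters k"] by (simp add: cscale_uea_def mult.assoc)
  next
    case (add a b)
    then show ?case by (simp add: lin_ext_add distrib_right)
  qed
  then show ?thesis by (simp add: uea_incl_def uea_act_def)
qed

lemma uea_incl_gen: "uea_incl (uea_gen x) = uea_gen (of_zn x)"
  by (simp add: uea_incl_def zn_lmult.uea_act_gen)

lemma uea_incl_const: "uea_incl (uea_const c) = uea_const c"
  by (simp add: uea_incl_def zn_lmult.uea_act_const cscale_uea_def)

lemma uea_cases: obtains a where "u = abs_uea a"
  by (metis Quotient3_abs_rep[OF Quotient3_uea])

lemma uea_incl_add: "uea_incl (s + t) = uea_incl s + uea_incl t"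
  by (cases s rule: uea_cases, cases t rule: uea_cases)
    (simp add: uea_incl_def plus_uea.abs_eq zn_lmult.uea_act_abs zn_lmult.fa_act_add_left)

lemma uea_incl_mult: "uea_incl (s * t) = uea_incl s * uea_incl t"
proof -
  have "uea_incl (s * t) = uea_act (\<lambda>x u. uea_gen (of_zn x) * u) s (uea_incl t)"
    by (cases s rule: uea_cases, cases t rule: uea_cases)
      (simp add: uea_incl_def times_uea.abs_eq zn_lmult.uea_act_abs zn_lmult.fa_act_mult)
  then show ?thesis by (simp add: uea_act_zn_lmult)
qed


section \<open>The induced module\<close>

text \<open>
  Modules over \<open>\<complex>z \<oplus> \<nn>\<^sup>+\<close> form a class so that the induced module can be
  a type constructor; the axioms are those of \<^locale>\<open>lie_module\<close>.
\<close>

class zn_module = complex_vec +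
  fixes zn_act :: "vir_zn \<Rightarrow> 'a \<Rightarrow> 'a"
  assumes zn_act_add_left: "zn_act (x + y) v = zn_act x v + zn_act y v"
    and zn_act_add_right: "zn_act x (v + w) = zn_act x v + zn_act x w"
    and zn_act_cscale_left: "zn_act (c *\<^sub>C x) v = c *\<^sub>C zn_act x v"
    and zn_act_cscale_right: "zn_act x (c *\<^sub>C v) = c *\<^sub>C zn_act x v"
    and zn_act_bracket: "zn_act (bracket x y) v = zn_act x (zn_act y v) - zn_act y (zn_act x v)"

lemma zn_lie_module: "lie_module (zn_act :: vir_zn \<Rightarrow> 'n \<Rightarrow> 'n::zn_module)"
  by unfold_locales (fact zn_act_add_left zn_act_add_right zn_act_cscale_left
      zn_act_cscale_right zn_act_bracket)+

text \<open>
  For a right action \<open>rm\<close> of a ring on \<open>M\<close> and a left action \<open>lm\<close> on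
  \<open>N\<close>: the subgroup of relations of the free abelian group on \<open>M \<times> N\<close> whose
  quotient is the tensor product over that ring.
\<close>

inductive_set tensor_rel ::
    "('m::ab_group_add \<Rightarrow> 'r \<Rightarrow> 'm) \<Rightarrow> ('r \<Rightarrow> 'n::ab_group_add \<Rightarrow> 'n) \<Rightarrow> ('m \<times> 'n \<Rightarrow>\<^sub>0 int) set"
  for rm lm where
  zero: "0 \<in> tensor_rel rm lm"
| add_left: "frag_of (u + u', n) - frag_of (u, n) - frag_of (u', n) \<in> tensor_rel rm lm"
| add_right: "frag_of (u, n + n') - frag_of (u, n) - frag_of (u, n') \<in> tensor_rel rm lm"
| balanced: "frag_of (rm u t, n) - frag_of (u, lm t n) \<in> tensor_rel rm lm"
| diff: "a \<in> tensor_rel rm lm \<Longrightarrow> b \<in> tensor_rel rm lm \<Longrightarrow> a - b \<in> tensor_rel rm lm"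

lemma tensor_rel_uminus: "a \<in> tensor_rel rm lm \<Longrightarrow> - a \<in> tensor_rel rm lm"
  using tensor_rel.diff[OF tensor_rel.zero] by fastforce

lemma tensor_rel_add: "a \<in> tensor_rel rm lm \<Longrightarrow> b \<in> tensor_rel rm lm \<Longrightarrow> a + b \<in> tensor_rel rm lm"
  using tensor_rel.diff[OF _ tensor_rel_uminus, of a rm lm b] by simp

definition ind_rel :: "(virasoro uea \<times> 'n::zn_module \<Rightarrow>\<^sub>0 int) set" where
  "ind_rel = tensor_rel (\<lambda>u t. u * uea_incl t) (uea_act zn_act)"

text \<open>\<open>'n induced\<close> is \<open>U(\<gg>) \<otimes> N\<close>, tensored over \<open>U(\<complex>z \<oplus> \<nn>\<^sup>+)\<close>.\<close>

quotient_type (overloaded) 'n induced =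
  "virasoro uea \<times> 'n::zn_module \<Rightarrow>\<^sub>0 int" / "\<lambda>a b. a - b \<in> ind_rel"
proof (rule equivpI)
  show "reflp (\<lambda>a b :: virasoro uea \<times> 'n \<Rightarrow>\<^sub>0 int. a - b \<in> ind_rel)"
    by (simp add: reflp_def ind_rel_def tensor_rel.zero)
  show "symp (\<lambda>a b :: virasoro uea \<times> 'n \<Rightarrow>\<^sub>0 int. a - b \<in> ind_rel)"
    unfolding ind_rel_def by (rule sympI) (use tensor_rel_uminus in fastforce)
  show "transp (\<lambda>a b :: virasoro uea \<times> 'n \<Rightarrow>\<^sub>0 int. a - b \<in> ind_rel)"
    unfolding ind_rel_def by (rule transpI) (use tensor_rel_add in fastforce)
qed

instantiation induced :: (zn_module) ab_group_add
begin
lift_definition zero_induced :: "'a induced" is 0 .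
lift_definition plus_induced :: "'a induced \<Rightarrow> 'a induced \<Rightarrow> 'a induced" is "(+)"
  unfolding ind_rel_def by (metis add_diff_add tensor_rel_add)
lift_definition uminus_induced :: "'a induced \<Rightarrow> 'a induced" is "uminus"
  unfolding ind_rel_def by (metis minus_diff_minus tensor_rel_uminus)
lift_definition minus_induced :: "'a induced \<Rightarrow> 'a induced \<Rightarrow> 'a induced" is "(-)"
proof -
  fix a b c d :: "virasoro uea \<times> 'a \<Rightarrow>\<^sub>0 int"
  assume "a - b \<in> ind_rel" "c - d \<in> ind_rel"
  from tensor_rel.diff[OF this[unfolded ind_rel_def]] show "a - c - (b - d) \<in> ind_rel"
    by (simp add: algebra_simps ind_rel_def)
qed
instance
  by standard (transfer, simp add: algebra_simps ind_rel_def tensor_rel.zero)+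
end

definition ind_tensor :: "virasoro uea \<Rightarrow> 'n::zn_module \<Rightarrow> 'n induced" where
  "ind_tensor u n = abs_induced (frag_of (u, n))"

lemma abs_induced_eq_iff: "abs_induced a = abs_induced b \<longleftrightarrow> a - b \<in> ind_rel"
  using Quotient3_rel[OF Quotient3_induced, of a b]
  by (simp add: ind_rel_def tensor_rel.zero)

lemma ind_tensor_add_left: "ind_tensor (u + u') n = ind_tensor u n + ind_tensor u' n"
  using tensor_rel.add_left
  by (simp add: ind_tensor_def plus_induced.abs_eq abs_induced_eq_iff ind_rel_def diff_diff_eq)

lemma ind_tensor_add_right: "ind_tensor u (n + n') = ind_tensor u n + ind_tensor u n'"
  using tensor_rel.add_right
  by (simp add: ind_tensor_def plus_induced.abs_eq abs_induced_eq_iff ind_rel_def diff_diff_eq)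

lemma ind_tensor_balanced: "ind_tensor (u * uea_incl t) n = ind_tensor u (uea_act zn_act t n)"
  using tensor_rel.balanced[of "\<lambda>u t. u * uea_incl t" u t n]
  by (simp add: ind_tensor_def abs_induced_eq_iff ind_rel_def)

lemma ind_rel_lmult:
  "a \<in> ind_rel \<Longrightarrow> frag_extend (\<lambda>(u, n). frag_of (w * u, n)) a \<in> ind_rel"
  unfolding ind_rel_def
proof (induction a rule: tensor_rel.induct)
  case zero show ?case by (simp add: tensor_rel.zero)
next
  case (balanced u t n)
  then show ?case
    using tensor_rel.balanced[of "\<lambda>u t. u * uea_incl t" "w * u" t n "uea_act zn_act"]
    by (simp add: frag_extend_diff mult.assoc)
qed (simp_all add: frag_extend_diff tensor_rel.intros distrib_left)

definition ind_lmult :: "virasoro uea \<Rightarrow> 'n::zn_module induced \<Rightarrow> 'n induced" where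
  "ind_lmult w a = abs_induced (frag_extend (\<lambda>(u, n). frag_of (w * u, n)) (rep_induced a))"

lemma induced_cases: obtains c where "a = abs_induced c"
  by (metis Quotient3_abs_rep[OF Quotient3_induced])

lemma ind_lmult_abs:
  "ind_lmult w (abs_induced c) = abs_induced (frag_extend (\<lambda>(u, n). frag_of (w * u, n)) c)"
proof -
  have "abs_induced (rep_induced (abs_induced c)) = abs_induced c"
    by (rule Quotient3_abs_rep[OF Quotient3_induced])
  then have "rep_induced (abs_induced c) - c \<in> ind_rel" by (simp only: abs_induced_eq_iff)
  from ind_rel_lmult[OF this, of w] show ?thesis
    by (simp add: ind_lmult_def abs_induced_eq_iff frag_extend_diff)
qed

lemma ind_lmult_tensor: "ind_lmult w (ind_tensor u n) = ind_tensor (w * u) n"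
  by (simp add: ind_tensor_def ind_lmult_abs)

lemma ind_lmult_diff: "ind_lmult w (a - b) = ind_lmult w a - ind_lmult w b"
  by (cases a rule: induced_cases, cases b rule: induced_cases)
    (simp add: minus_induced.abs_eq ind_lmult_abs frag_extend_diff)

lemma ind_lmult_add: "ind_lmult w (a + b) = ind_lmult w a + ind_lmult w b"
  by (cases a rule: induced_cases, cases b rule: induced_cases)
    (simp add: plus_induced.abs_eq ind_lmult_abs frag_extend_add)

lemma ind_lmult_0: "ind_lmult w 0 = 0"
  using ind_lmult_diff[of w 0 0] by simp

lemma induced_induct [case_names zero tensor diff]:
  assumes "P 0" "\<And>u n. P (ind_tensor u n)" "\<And>a b. P a \<Longrightarrow> P b \<Longrightarrow> P (a - b)"
  shows "P (w :: 'n::zn_module induced)"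
proof -
  have "P (abs_induced c)" for c
    using subset_UNIV
  proof (induction c rule: frag_induction)
    case zero then show ?case using assms(1) by (simp add: zero_induced_def)
  next
    case (one x)
    then show ?case using assms(2)[of "fst x" "snd x"] by (simp add: ind_tensor_def)
  next
    case (diff a b)
    then show ?case using assms(3) by (simp add: minus_induced.abs_eq[symmetric])
  qed
  then show ?thesis by (cases w rule: induced_cases) simp
qed

lemma ind_lmult_plus: "ind_lmult (w + w') a = ind_lmult w a + ind_lmult w' a"
  by (induction a rule: induced_induct)
    (simp_all add: ind_lmult_0 ind_lmult_tensor ind_lmult_diff distrib_right ind_tensor_add_left)

lemma ind_lmult_mult: "ind_lmult (w * w') a = ind_lmult w (ind_lmult w' a)"
  by (induction a rule: induced_induct)
    (simp_all add: ind_lmult_0 ind_lmult_tensor ind_lmult_diff mult.assoc)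

lemma ind_lmult_one: "ind_lmult 1 a = a"
  by (induction a rule: induced_induct)
    (simp_all add: ind_lmult_0 ind_lmult_tensor ind_lmult_diff)

instantiation induced :: (zn_module) complex_vec
begin
definition cscale_induced :: "complex \<Rightarrow> 'a induced \<Rightarrow> 'a induced" where
  "cscale_induced c = ind_lmult (uea_const c)"
instance
  by standard (simp_all add: cscale_induced_def ind_lmult_add ind_lmult_plus ind_lmult_mult
      ind_lmult_one uea_const_add uea_const_mult)
end

lemma ind_tensor_cscale_left: "ind_tensor (c *\<^sub>C u) n = c *\<^sub>C ind_tensor u n"
  by (simp add: cscale_induced_def cscale_uea_def ind_lmult_tensor)

lemma ind_tensor_cscale_right: "ind_tensor u (c *\<^sub>C n) = c *\<^sub>C ind_tensor u n"
proof -
  have "uea_act zn_act (uea_const c) n = c *\<^sub>C n"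
    by (rule lie_module.uea_act_const[OF zn_lie_module])
  then have "ind_tensor u (c *\<^sub>C n) = ind_tensor (u * uea_const c) n"
    by (metis ind_tensor_balanced uea_incl_const)
  then show ?thesis
    by (simp add: cscale_induced_def ind_lmult_tensor uea_const_central)
qed

definition ind_act :: "virasoro \<Rightarrow> 'n::zn_module induced \<Rightarrow> 'n induced" where
  "ind_act x = ind_lmult (uea_gen x)"

global_interpretation ind_module: lie_module ind_act
proof
  fix x y :: virasoro and c and a b :: "'n::zn_module induced"
  show "ind_act (x + y) a = ind_act x a + ind_act y a"
    by (simp add: ind_act_def uea_gen_add ind_lmult_plus)
  show "ind_act x (a + b) = ind_act x a + ind_act x b"
    by (simp add: ind_act_def ind_lmult_add)
  show "ind_act (c *\<^sub>C x) a = c *\<^sub>C ind_act x a"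
    by (simp add: ind_act_def uea_gen_cscale ind_lmult_mult cscale_induced_def)
  show "ind_act x (c *\<^sub>C a) = c *\<^sub>C ind_act x a"
    by (simp add: ind_act_def cscale_induced_def ind_lmult_mult[symmetric] uea_const_central)
  have "uea_gen x * uea_gen y = uea_gen (bracket x y) + uea_gen y * uea_gen x"
    by (simp add: uea_gen_bracket)
  then have "ind_act x (ind_act y a) = ind_act (bracket x y) a + ind_act y (ind_act x a)"
    by (simp add: ind_act_def ind_lmult_mult[symmetric] ind_lmult_plus[symmetric])
  then show "ind_act (bracket x y) a = ind_act x (ind_act y a) - ind_act y (ind_act x a)"
    by simp
qed

lemma ind_act_tensor: "ind_act x (ind_tensor u n) = ind_tensor (uea_gen x * u) n"
  by (simp add: ind_act_def ind_lmult_tensor)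

lemma ind_act_one_tensor: "ind_act (of_zn x) (ind_tensor 1 n) = ind_tensor 1 (zn_act x n)"
proof -
  have "uea_act zn_act (uea_gen x) n = zn_act x n"
    by (rule lie_module.uea_act_gen[OF zn_lie_module])
  then show ?thesis
    using ind_tensor_balanced[of 1 "uea_gen x" n] by (simp add: ind_act_tensor uea_incl_gen)
qed


section \<open>Whittaker vectors\<close>

text \<open>
  Functionals on \<open>\<nn>\<^sup>+\<close> are functions on the Virasoro algebra of which only the
  restriction to \<open>nplus\<close> is relevant. The functionals satisfying \<open>nplus_hom\<close> are
  those that factor through the abelianization of \<open>\<nn>\<^sup>+\<close>.
\<close>

definition nplus_dual :: "(virasoro \<Rightarrow> complex) \<Rightarrow> bool" where
  "nplus_dual f \<longleftrightarrow>
     (\<forall>x\<in>nplus. \<forall>y\<in>nplus. f (x + y) = f x + f y) \<and> (\<forall>c. \<forall>x\<in>nplus. f (c *\<^sub>C x) = c * f x)"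

definition nplus_hom :: "(virasoro \<Rightarrow> complex) \<Rightarrow> bool" where
  "nplus_hom f \<longleftrightarrow> nplus_dual f \<and> (\<forall>x\<in>nplus. \<forall>y\<in>nplus. f (bracket x y) = 0)"

definition dfunctional :: "(virasoro \<Rightarrow> complex) \<Rightarrow> virasoro \<Rightarrow> complex" where
  "dfunctional f x =
     lin_ext (\<lambda>i. case i of Zi \<Rightarrow> 0 | Di k \<Rightarrow> of_int k * f (vir_d k)) (vir_coeffs x)"

lemma dfunctional_d: "dfunctional f (vir_d k) = of_int k * f (vir_d k)"
  by (simp add: dfunctional_def)

lemma nplus_dual_dfunctional: "nplus_dual (dfunctional f)"
  by (simp add: nplus_dual_def dfunctional_def vir_coeffs_add vir_coeffs_cscale lin_ext_add
      lin_ext_map_scale cscale_complex_def)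

definition whittaker_vectors ::
    "(virasoro \<Rightarrow> 'v \<Rightarrow> 'v) \<Rightarrow> (virasoro \<Rightarrow> complex) \<Rightarrow> 'v::complex_vec set" where
  "whittaker_vectors act \<psi> = {w. \<forall>x\<in>nplus. act x w = \<psi> x *\<^sub>C w}"

end

theory Submission
  imports Defs
begin

text \<open>
Let \<open>\<chi> k = \<psi> (d\<^sub>k)\<close>. Since \<open>\<psi>\<close> kills brackets, \<open>\<chi> k = 0\<close> for \<open>k \<ge> 3\<close>, and \<open>\<chi> 2 \<noteq> 0\<close>.

\<^bold>\<open>Coordinates on the induced module.\<close> By a Poincare-Birkhoff-Witt argument \<open>V\<^sub>N\<close> has the
vectors \<open>d\<^sub>k\<^sub>1 \<dots> d\<^sub>k\<^sub>r \<otimes> n\<close> with \<open>k\<^sub>1 \<le> \<dots> \<le> k\<^sub>r \<le> 0\<close> as its normal forms. The locale \<open>positive_module\<close> rewrites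
an arbitrary word in the \<open>d\<^sub>k\<close> to normal form (\<open>nf\<close>): descents are exchanged at the cost of a
bracket, and a positive last letter is absorbed by \<open>N\<close>. The result does not depend on the order of
the steps (\<open>nf_commute\<close>, where the Jacobi identity enters, and \<open>nf_last\<close>, where the module axiom of \<open>N\<close>
enters), so the words with coefficients in \<open>N\<close> carry an action of the Virasoro algebra.
Its comparison with \<open>V\<^sub>N\<close> (\<open>whittaker_vector_representative\<close>) represents each Whittaker vector by a
combination of normal words on which \<open>d\<^sub>k\<close> acts by \<open>\<chi> k\<close>.

\<^bold>\<open>Rank one.\<close> Suppose first that \<open>N = \<complex>\<close> with \<open>d\<^sub>k\<close> acting by \<open>\<chi> k\<close>. Give the letter
\<open>d\<^sub>-\<^sub>r\<close> the weight \<open>r + 1\<close>. Moving \<open>d\<^sub>k\<close> to the right through a word replaces some letters by one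
bracket, and the largest weight that can survive arises when \<open>d\<^sub>k\<close> meets \<open>d\<^sub>2\<^sub>-\<^sub>k\<close> and the bracket \<open>(2k - 2) d\<^sub>2\<close> acts by
\<open>(2k - 2) \<chi> 2\<close>. Hence the leading part of \<open>d\<^sub>k - \<chi> k\<close> is, up to the factor \<open>(2k - 2) \<chi> 2\<close>, the partial
derivative with respect to the letter \<open>d\<^sub>2\<^sub>-\<^sub>k\<close> (\<open>defect_leading_term\<close>). If all \<open>(d\<^sub>k - \<chi> k) p\<close> are
constants and \<open>p\<close> is not, the leading part of \<open>p\<close> has constant partial derivatives, so it is a multiple of a single
letter \<open>d\<^sub>j\<close>; and \<open>j < 0\<close> is impossible because \<open>d\<^sub>1 - \<chi> 1\<close> turns \<open>d\<^sub>j\<close> into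
\<open>(1 - j) d\<^sub>j\<^sub>+\<^sub>1\<close> plus terms of lower weight. So \<open>p\<close> lies in the span of \<open>1\<close> and \<open>d\<^sub>0\<close>, and
\<open>(d\<^sub>k - \<chi> k) d\<^sub>0 = k \<chi> k\<close> is exactly \<open>D\<psi>\<close> (\<open>scalar_defect\<close>).

\<^bold>\<open>General rank.\<close> Let \<open>j\<close> be the largest index of a \<open>v\<^sub>j\<close> that occurs in a Whittaker vector. Its
coordinate along \<open>v\<^sub>j\<close> is a Whittaker vector of the rank one module, hence a constant \<open>a \<noteq> 0\<close>. If \<open>j = 1\<close>,
the vector is \<open>a v\<^sub>1\<close>. If \<open>j > 1\<close>, the coordinate \<open>u\<close> along \<open>v\<^sub>j\<^sub>-\<^sub>1\<close> satisfies
\<open>(d\<^sub>k - \<chi> k) u = - a \<alpha>(j-1, j)(d\<^sub>k)\<close>, and the rank one result makes \<open>\<alpha>(j-1, j)\<close> a multiple of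
\<open>D\<psi>\<close>, contrary to the assumption.
\<close>

section \<open>Finitely supported functions with values in a vector space\<close>

lemma lookup_map_additive:
  "f 0 = 0 \<Longrightarrow> Poly_Mapping.lookup (Poly_Mapping.map f p) k = f (Poly_Mapping.lookup p k)"
  by transfer (auto simp: when_def)

text \<open>
Below, \<^typ>\<open>int list \<Rightarrow>\<^sub>0 'n\<close> plays the part of \<open>U(\<gg>) \<otimes> N\<close>: the letter \<open>k\<close> stands for \<open>d\<^sub>k\<close>, and the word
\<open>w\<close> with coefficient \<open>n\<close> stands for \<open>w \<otimes> n\<close>.
\<close>

instantiation poly_mapping :: (type, complex_vec) complex_vec
begin
definition cscale_poly_mapping :: "complex \<Rightarrow> ('a \<Rightarrow>\<^sub>0 'b) \<Rightarrow> 'a \<Rightarrow>\<^sub>0 'b" where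
  "cscale_poly_mapping c = Poly_Mapping.map (cscale c)"
instance
  by standard (auto intro!: poly_mapping_eqI simp: cscale_poly_mapping_def lookup_map_additive
      lookup_add cscale_add_left cscale_add_right cscale_cscale)
end

lemma lookup_cscale [simp]:
  "Poly_Mapping.lookup (c *\<^sub>C p) k = c *\<^sub>C Poly_Mapping.lookup p k"
  by (simp add: cscale_poly_mapping_def lookup_map_additive)

lemma cscale_single [simp]:
  "c *\<^sub>C Poly_Mapping.single k x = Poly_Mapping.single k (c *\<^sub>C x)"
  by (intro poly_mapping_eqI) (simp add: lookup_single when_def)

lemma keys_cscale: "Poly_Mapping.keys (c *\<^sub>C p) \<subseteq> Poly_Mapping.keys p"
  by (auto simp: in_keys_iff)

text \<open>
For additive \<open>f k\<close> this is the additive map that sends \<open>k \<otimes> n\<close> to \<open>f k n\<close>. Abelian groups suffice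
here; with integers as coefficients it gives maps out of the free abelian group that presents a tensor product.
\<close>

definition lift_sum :: "('k \<Rightarrow> 'a::ab_group_add \<Rightarrow> 'p::ab_group_add) \<Rightarrow> ('k \<Rightarrow>\<^sub>0 'a) \<Rightarrow> 'p" where
  "lift_sum f p = (\<Sum>k\<in>Poly_Mapping.keys p. f k (Poly_Mapping.lookup p k))"

lemma lift_sum_zero [simp]: "lift_sum f 0 = 0"
  by (simp add: lift_sum_def)

lemma sum_single_keys:
  "(\<Sum>k\<in>Poly_Mapping.keys p. Poly_Mapping.single k (Poly_Mapping.lookup p k)) = p"
  by (intro poly_mapping_eqI)
    (auto simp: lookup_sum lookup_single when_def in_keys_iff sum.delta)

context
  fixes f :: "'k \<Rightarrow> 'a::ab_group_add \<Rightarrow> 'p::ab_group_add"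
  assumes add: "\<And>k x y. f k (x + y) = f k x + f k y"
begin

lemma additive_zero: "f k 0 = 0"
  using add[of k 0 0] by simp

lemma lift_sum_superset:
  "finite S \<Longrightarrow> Poly_Mapping.keys p \<subseteq> S \<Longrightarrow>
    lift_sum f p = (\<Sum>k\<in>S. f k (Poly_Mapping.lookup p k))"
  unfolding lift_sum_def
  by (rule sum.mono_neutral_left) (auto simp: in_keys_iff additive_zero)

lemma lift_sum_single [simp]: "lift_sum f (Poly_Mapping.single k x) = f k x"
  by (simp add: lift_sum_def additive_zero)

lemma lift_sum_add: "lift_sum f (p + q) = lift_sum f p + lift_sum f q"
proof -
  let ?S = "Poly_Mapping.keys p \<union> Poly_Mapping.keys q"
  have "Poly_Mapping.keys (p + q) \<subseteq> ?S" by (rule Poly_Mapping.keys_add)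
  then show ?thesis
    by (simp add: lift_sum_superset[of ?S] lookup_add add sum.distrib)
qed

lemma lift_sum_diff: "lift_sum f (p - q) = lift_sum f p - lift_sum f q"
  using lift_sum_add[of "p - q" q] by simp

end

lemma lift_sum_cscale:
  fixes f :: "'k \<Rightarrow> 'a::complex_vec \<Rightarrow> 'p::complex_vec"
  assumes "\<And>k x y. f k (x + y) = f k x + f k y" and "\<And>k c x. f k (c *\<^sub>C x) = c *\<^sub>C f k x"
  shows "lift_sum f (c *\<^sub>C p) = c *\<^sub>C lift_sum f p"
  using lift_sum_superset[of f, OF assms(1) finite_keys keys_cscale, of c p] assms(2)
  by (simp add: lift_sum_def cvec.scale_sum_right)


lemma poly_mapping_single_induct [case_names zero add]:
  assumes "P 0" and "\<And>w x p. P p \<Longrightarrow> P (Poly_Mapping.single w x + p)"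
  shows "P (p :: 'k \<Rightarrow>\<^sub>0 'a::comm_monoid_add)"
proof -
  have "P (\<Sum>k\<in>S. Poly_Mapping.single k (f k))" if "finite S" for S and f :: "'k \<Rightarrow> 'a"
    using that by induction (use assms in auto)
  from this[of "Poly_Mapping.keys p" "Poly_Mapping.lookup p"] show ?thesis
    by (simp add: sum_single_keys)
qed

section \<open>Normal forms of words\<close>

text \<open>
Exchanging a descent lowers the number of inversions and keeps the length, while a bracket shortens
the word; rewriting therefore terminates for the lexicographic combination of both.
\<close>

fun inversions :: "int list \<Rightarrow> nat" where
  "inversions [] = 0"
| "inversions (k # w) = length (filter (\<lambda>j. j < k) w) + inversions w"

definition word_order :: "(int list \<times> int list) set" where
  "word_order = measures [length, inversions]"

lemma wf_word_order: "wf word_order"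
  by (simp add: word_order_def)

lemma word_order_shorter: "length w' < length w \<Longrightarrow> (w', w) \<in> word_order"
  by (simp add: word_order_def)

lemma word_order_swap: "j < k \<Longrightarrow> (a @ j # k # b, a @ k # j # b) \<in> word_order"
  by (induction a) (auto simp: word_order_def)

lemma unsorted_has_descent:
  "\<not> sorted w \<Longrightarrow> \<exists>a k j b. w = a @ k # j # b \<and> j < (k::int)"
proof (induction w rule: induct_list012)
  case (3 x y zs)
  show ?case
  proof (cases "y < x")
    case True
    then show ?thesis by (intro exI[of _ "[]"]) auto
  next
    case False
    then have "\<not> sorted (y # zs)" using 3(3) by (meson linorder_not_less sorted2)
    then obtain a k j b where "y # zs = a @ k # j # b" "j < k" using 3(2) by blast
    then show ?thesis by (intro exI[of _ "x # a"]) auto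
  qed
qed auto

text \<open>
Normal words index the monomials of the Poincare-Birkhoff-Witt basis of \<open>U(span {d\<^sub>k | k \<le> 0})\<close>.
\<close>

definition normal_word :: "int list \<Rightarrow> bool" where
  "normal_word w \<longleftrightarrow> sorted w \<and> (\<forall>k\<in>set w. k \<le> 0)"

lemma normal_Cons: "normal_word (j # w) \<longleftrightarrow> j \<le> 0 \<and> (\<forall>k\<in>set w. j \<le> k) \<and> normal_word w"
  by (auto simp: normal_word_def)

lemma normal_remove1: "normal_word w \<Longrightarrow> normal_word (remove1 k w)"
  unfolding normal_word_def by (meson notin_set_remove1 sorted_remove1 subsetD set_remove1_subset)

lemma word_cases [case_names normal last descent]:
  assumes "normal_word w \<Longrightarrow> thesis"
    and "\<And>a k. w = a @ [k] \<Longrightarrow> 0 < k \<Longrightarrow> sorted w \<Longrightarrow> thesis"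
    and "\<not> sorted w \<Longrightarrow> thesis"
  shows thesis
proof (cases "sorted w")
  case True
  show ?thesis
  proof (cases w rule: rev_cases)
    case Nil
    then show ?thesis using assms(1) by (simp add: normal_word_def)
  next
    case (snoc a k)
    show ?thesis
    proof (cases "0 < k")
      case False
      then have "normal_word w"
        using True snoc by (fastforce simp: normal_word_def sorted_append)
      then show ?thesis by (rule assms(1))
    qed (use True snoc assms(2) in blast)
  qed
qed (rule assms(3))

text \<open>
The endomorphisms \<open>\<rho> k\<close> give the action of \<open>d\<^sub>k\<close>, for \<open>k > 0\<close>, on the module \<open>N\<close> to be induced, and \<open>\<xi>\<close> is the
scalar by which \<open>z\<close> acts. As \<open>z\<close> is central, it needs no letter of its own: it is replaced by
\<open>\<xi>\<close> wherever a bracket produces it.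
\<close>

locale positive_module =
  fixes \<rho> :: "int \<Rightarrow> 'n::complex_vec \<Rightarrow> 'n" and \<xi> :: complex
  assumes rho_add: "\<rho> k (x + y) = \<rho> k x + \<rho> k y"
    and rho_cscale: "\<rho> k (c *\<^sub>C x) = c *\<^sub>C \<rho> k x"
    and rho_commute: "0 < k \<Longrightarrow> 0 < j \<Longrightarrow>
      \<rho> k (\<rho> j x) = \<rho> j (\<rho> k x) + of_int (k - j) *\<^sub>C \<rho> (k + j) x"
begin

definition cocycle :: "int \<Rightarrow> int \<Rightarrow> complex" where
  "cocycle k j = (if j = - k then of_int (k ^ 3 - k) / 12 * \<xi> else 0)"

text \<open>
Some descent is chosen for rewriting; that the choice does not matter is the content of
\<open>nf_commute\<close> below.
\<close>

function nf :: "int list \<Rightarrow> 'n \<Rightarrow> (int list \<Rightarrow>\<^sub>0 'n)" where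
  "nf w x =
    (if sorted w then
       if w \<noteq> [] \<and> 0 < last w then nf (butlast w) (\<rho> (last w) x) else Poly_Mapping.single w x
     else case SOME (a, k, j, b). w = a @ k # j # b \<and> j < k of (a, k, j, b) \<Rightarrow>
       nf (a @ j # k # b) x + of_int (k - j) *\<^sub>C nf (a @ (k + j) # b) x
         + cocycle k j *\<^sub>C nf (a @ b) x)"
  by pat_completeness auto
termination
proof (relation "inv_image word_order fst")
  show "wf (inv_image word_order fst :: ((int list \<times> 'n) \<times> (int list \<times> 'n)) set)"
    using wf_word_order by (rule wf_inv_image)
next
  fix w :: "int list" and x :: 'n
  assume "w \<noteq> [] \<and> 0 < last w"
  then show "((butlast w, \<rho> (last w) x), w, x) \<in> inv_image word_order fst"
    by (auto intro: word_order_shorter)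
next
  fix w :: "int list" and x :: 'n and a u k v j b
  assume ns: "\<not> sorted w"
    and eq: "(a, u) = (SOME (a, k, j, b). w = a @ k # j # b \<and> j < k)"
      "(k, v) = u" "(j, b) = v"
  have "case (a, k, j, b) of (a, k, j, b) \<Rightarrow> w = a @ k # j # b \<and> j < k"
    unfolding eq by (rule someI_ex) (use unsorted_has_descent[OF ns] in auto)
  then have w: "w = a @ k # j # b" "j < k" by auto
  from w(2) show "((a @ j # k # b, x), w, x) \<in> inv_image word_order fst"
    by (simp add: w(1) word_order_swap)
  show "((a @ (k + j) # b, x), w, x) \<in> inv_image word_order fst"
    and "((a @ b, x), w, x) \<in> inv_image word_order fst"
    by (auto simp: w(1) intro: word_order_shorter)
qed

declare nf.simps [simp del]

text \<open>
The contribution of \<open>[d\<^sub>k, d\<^sub>j]\<close> when the letters \<open>k\<close> and \<open>j\<close> between \<open>a\<close> and \<open>b\<close> are exchanged.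
\<close>

definition bracket_term :: "int list \<Rightarrow> int \<Rightarrow> int \<Rightarrow> int list \<Rightarrow> 'n \<Rightarrow> (int list \<Rightarrow>\<^sub>0 'n)" where
  "bracket_term a k j b x =
     of_int (k - j) *\<^sub>C nf (a @ (k + j) # b) x + cocycle k j *\<^sub>C nf (a @ b) x"

lemma nf_normal: "normal_word w \<Longrightarrow> nf w x = Poly_Mapping.single w x"
  by (subst nf.simps) (metis last_in_set linorder_not_less normal_word_def)

lemma nf_sorted_last: "sorted (a @ [k]) \<Longrightarrow> 0 < k \<Longrightarrow> nf (a @ [k]) x = nf a (\<rho> k x)"
  by (subst nf.simps) auto

lemma nf_descent_ex:
  assumes "\<not> sorted w"
  obtains a k j b where "w = a @ k # j # b" "j < k"
    "\<And>x. nf w x = nf (a @ j # k # b) x + bracket_term a k j b x"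
proof -
  define p where "p = (SOME (a, k, j, b). w = a @ k # j # b \<and> j < k)"
  obtain a k j b where pe: "p = (a, k, j, b)" by (cases p)
  have "case p of (a, k, j, b) \<Rightarrow> w = a @ k # j # b \<and> j < k"
    unfolding p_def by (rule someI_ex) (use unsorted_has_descent[OF assms] in auto)
  then have w: "w = a @ k # j # b" "j < k" by (auto simp: pe)
  have "nf w x = nf (a @ j # k # b) x + bracket_term a k j b x" for x
    using assms by (subst nf.simps) (simp add: p_def[symmetric] pe bracket_term_def add.assoc)
  with w show ?thesis by (rule that)
qed

lemma bracket_term_flip: "bracket_term a k j b x = - bracket_term a j k b x"
proof -
  have "of_int (k - j) = - (of_int (j - k) :: complex)" by simp
  moreover have "cocycle k j = - cocycle j k" by (auto simp: cocycle_def field_simps)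
  ultimately show ?thesis
    unfolding bracket_term_def by (simp only: cvec.scale_minus_left add.commute[of k j]) simp
qed

text \<open>
Independence of the choice: every descent of \<open>w\<close>, and not just the chosen one, may be used to compute
the normal form.
\<close>

definition reducible_at_descents :: "int list \<Rightarrow> bool" where
  "reducible_at_descents w \<longleftrightarrow> (\<forall>a k j b x. w = a @ k # j # b \<longrightarrow> j < k \<longrightarrow>
     nf w x = nf (a @ j # k # b) x + bracket_term a k j b x)"

lemma reducible_any:
  assumes "\<And>w. length w = length a + length b + 2 \<Longrightarrow> reducible_at_descents w"
  shows "nf (a @ k # j # b) x = nf (a @ j # k # b) x + bracket_term a k j b x"
proof (cases k j rule: linorder_cases)
  case less
  then have "nf (a @ j # k # b) x = nf (a @ k # j # b) x + bracket_term a j k b x"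
    using assms[of "a @ j # k # b"] by (simp add: reducible_at_descents_def)
  then show ?thesis by (simp add: bracket_term_flip[of a k j])
next
  case equal
  then show ?thesis by (simp add: bracket_term_def cocycle_def)
next
  case greater
  then show ?thesis
    using assms[of "a @ k # j # b"] by (simp add: reducible_at_descents_def)
qed

text \<open>
Two descents without a common letter can be rewritten in either order, because all words that arise
after the first step are smaller and may by induction be rewritten at the other descent.
\<close>

lemma descents_apart:
  assumes IH: "\<And>w'. (w', a @ k # j # c @ k' # j' # b) \<in> word_order \<Longrightarrow> reducible_at_descents w'"
    and "j < k" "j' < k'"
  shows "nf (a @ j # k # c @ k' # j' # b) x + bracket_term a k j (c @ k' # j' # b) x
    = nf (a @ k # j # c @ j' # k' # b) x + bracket_term (a @ k # j # c) k' j' b x"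
proof -
  let ?w = "a @ k # j # c @ k' # j' # b"
  have sw: "(a @ j # k # c @ k' # j' # b, ?w) \<in> word_order"
    "(a @ k # j # c @ j' # k' # b, ?w) \<in> word_order"
    using word_order_swap[OF assms(2)] word_order_swap[OF assms(3), of "a @ k # j # c"] by auto
  have short: "reducible_at_descents u" if "length u < length ?w" for u
    using IH word_order_shorter that by blast
  have 1: "nf (a @ j # k # c @ k' # j' # b) x
      = nf (a @ j # k # c @ j' # k' # b) x + bracket_term (a @ j # k # c) k' j' b x"
    using IH[OF sw(1)] \<open>j' < k'\<close> unfolding reducible_at_descents_def
    by (metis append.assoc append_Cons)
  have 2: "nf (a @ k # j # c @ j' # k' # b) x
      = nf (a @ j # k # c @ j' # k' # b) x + bracket_term a k j (c @ j' # k' # b) x"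
    using IH[OF sw(2)] \<open>j < k\<close> unfolding reducible_at_descents_def by metis
  have A: "nf (a @ l # c @ k' # j' # b) x
      = nf (a @ l # c @ j' # k' # b) x + bracket_term (a @ l # c) k' j' b x" for l
    using reducible_any[of "a @ l # c" b k' j' x] short by simp
  have B: "nf (a @ c @ k' # j' # b) x = nf (a @ c @ j' # k' # b) x + bracket_term (a @ c) k' j' b x"
    using reducible_any[of "a @ c" b k' j' x] short by simp
  have C: "nf (a @ k # j # c @ l # b) x = nf (a @ j # k # c @ l # b) x + bracket_term a k j (c @ l # b) x" for l
    using reducible_any[of a "c @ l # b" k j x] short by simp
  have D: "nf (a @ k # j # c @ b) x = nf (a @ j # k # c @ b) x + bracket_term a k j (c @ b) x"
    using reducible_any[of a "c @ b" k j x] short by simp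
  have 3: "bracket_term a k j (c @ k' # j' # b) x - bracket_term a k j (c @ j' # k' # b) x
      = bracket_term (a @ k # j # c) k' j' b x - bracket_term (a @ j # k # c) k' j' b x"
    by (simp add: bracket_term_def A B C D cscale_add_right cscale_cscale mult.commute)
  show ?thesis using 3 by (simp add: 1 2 algebra_simps)
qed

lemma cocycle_jacobi:
  "of_int (k - i) * cocycle j (k + i) + of_int (j - i) * cocycle (j + i) k
    + of_int (k - j) * cocycle (k + j) i = 0"
proof (cases "i = - j - k")
  case True
  then show ?thesis by (simp add: cocycle_def) (simp add: field_simps power3_eq_cube)
next
  case False
  then have "k + i \<noteq> - j" "k \<noteq> - (j + i)" "i \<noteq> - (k + j)" by auto
  then show ?thesis by (simp add: cocycle_def)
qed

text \<open>
Overlapping descents \<open>k > j > i\<close>. Both ways of sorting the three letters end in \<open>i j k\<close>; the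
brackets they collect differ by \<open>[[k, j], i] + [[j, i], k] + [j, [k, i]]\<close>, which vanishes by the
Jacobi identity. That such a bracket of two letters may be evaluated inside a word is the induction
hypothesis for shorter words (\<open>C\<close> in the proof).
\<close>

lemma descents_adjacent:
  assumes IH: "\<And>w'. (w', a @ k # j # i # b) \<in> word_order \<Longrightarrow> reducible_at_descents w'"
    and "j < k" "i < j"
  shows "nf (a @ j # k # i # b) x + bracket_term a k j (i # b) x
    = nf (a @ k # i # j # b) x + bracket_term (a @ [k]) j i b x"
proof -
  let ?w = "a @ k # j # i # b"
  have red: "nf (a' @ m # l # b') x = nf (a' @ l # m # b') x + bracket_term a' m l b' x"
    if "l < m" "length (a' @ m # l # b') = length ?w"
      "inversions (a' @ m # l # b') < inversions ?w" for a' l m b'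
  proof -
    have "(a' @ m # l # b', ?w) \<in> word_order" using that by (simp add: word_order_def)
    from IH[OF this] show ?thesis using \<open>l < m\<close> by (simp add: reducible_at_descents_def)
  qed
  have inv: "inversions (a @ u) < inversions (a @ v)"
    if "inversions u < inversions v" "\<And>P. length (filter P u) = length (filter P v)" for u v
    using that
  proof (induction a)
    case (Cons y a)
    then show ?case using that(2) by simp
  qed simp
  have 1: "nf (a @ j # k # i # b) x = nf (a @ j # i # k # b) x + bracket_term (a @ [j]) k i b x"
    using red[of i k "a @ [j]" b] inv[of "j # k # i # b" "k # j # i # b"] assms by simp
  have 2: "nf (a @ j # i # k # b) x = nf (a @ i # j # k # b) x + bracket_term a j i (k # b) x"
    using red[of i j a "k # b"] inv[of "j # i # k # b" "k # j # i # b"] assms by simp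
  have 3: "nf (a @ k # i # j # b) x = nf (a @ i # k # j # b) x + bracket_term a k i (j # b) x"
    using red[of i k a "j # b"] inv[of "k # i # j # b" "k # j # i # b"] assms by simp
  have 4: "nf (a @ i # k # j # b) x = nf (a @ i # j # k # b) x + bracket_term (a @ [i]) k j b x"
    using red[of j k "a @ [i]" b] inv[of "i # k # j # b" "k # j # i # b"] assms by simp
  have C: "nf (a @ l # m # b) x = nf (a @ m # l # b) x + bracket_term a l m b x" for l m
    by (rule reducible_any) (rule IH, rule word_order_shorter, simp)
  have coeff: "of_int (k - i) * of_int (j - (k + i)) + of_int (j - i) * of_int (j + i - k)
      + of_int (k - j) * of_int (k + j - i) = (0::complex)"
    by (simp add: algebra_simps)
  let ?u = "nf (a @ (i + j + k) # b) x" and ?v = "nf (a @ b) x"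
  have e1: "bracket_term (a @ [j]) k i b x - bracket_term a k i (j # b) x = of_int (k - i) *\<^sub>C bracket_term a j (k + i) b x"
    using C[of j "k + i"] by (simp add: bracket_term_def cscale_add_right)
  have e2: "bracket_term a j i (k # b) x - bracket_term (a @ [k]) j i b x = of_int (j - i) *\<^sub>C bracket_term a (j + i) k b x"
    using C[of "j + i" k] by (simp add: bracket_term_def cscale_add_right)
  have e3: "bracket_term a k j (i # b) x - bracket_term (a @ [i]) k j b x = of_int (k - j) *\<^sub>C bracket_term a (k + j) i b x"
    using C[of "k + j" i] by (simp add: bracket_term_def cscale_add_right)
  have c: "bracket_term a j (k + i) b x = of_int (j - (k + i)) *\<^sub>C ?u + cocycle j (k + i) *\<^sub>C ?v"
    "bracket_term a (j + i) k b x = of_int (j + i - k) *\<^sub>C ?u + cocycle (j + i) k *\<^sub>C ?v"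
    "bracket_term a (k + j) i b x = of_int (k + j - i) *\<^sub>C ?u + cocycle (k + j) i *\<^sub>C ?v"
    by (simp_all add: bracket_term_def ac_simps)
  have "of_int (k - i) *\<^sub>C bracket_term a j (k + i) b x + of_int (j - i) *\<^sub>C bracket_term a (j + i) k b x
      + of_int (k - j) *\<^sub>C bracket_term a (k + j) i b x
    = (of_int (k - i) * of_int (j - (k + i)) + of_int (j - i) * of_int (j + i - k)
      + of_int (k - j) * of_int (k + j - i)) *\<^sub>C ?u
     + (of_int (k - i) * cocycle j (k + i) + of_int (j - i) * cocycle (j + i) k
      + of_int (k - j) * cocycle (k + j) i) *\<^sub>C ?v"
    unfolding c by (simp only: cscale_add_right cscale_add_left cscale_cscale ac_simps)
  also have "\<dots> = 0" by (simp only: coeff cocycle_jacobi) simp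
  finally show ?thesis unfolding 1 2 3 4 e1[symmetric] e2[symmetric] e3[symmetric]
    by (simp add: algebra_simps)
qed

lemma descents_confluent:
  assumes IH: "\<And>w'. (w', w) \<in> word_order \<Longrightarrow> reducible_at_descents w'"
    and w: "w = a @ k # j # b" "j < k" "w = a' @ k' # j' # b'" "j' < k'"
    and le: "length a \<le> length a'"
  shows "nf (a @ j # k # b) x + bracket_term a k j b x = nf (a' @ j' # k' # b') x + bracket_term a' k' j' b' x"
proof -
  obtain c where c: "a' = a @ c" "k # j # b = c @ k' # j' # b'"
    using w le by (auto simp: append_eq_append_conv2)
  consider "c = []" | "c = [k]" | d where "c = k # j # d"
  proof (cases c)
    case (Cons y d)
    then show ?thesis using c that by (cases d) auto
  qed (use that in blast)
  then show ?thesis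
  proof cases
    case 1
    then show ?thesis using c by simp
  next
    case 2
    then show ?thesis
      using c w descents_adjacent[of a k j j' b' x] IH by simp
  next
    case (3 d)
    then show ?thesis
      using c w descents_apart[of a k j d k' j' b' x] IH by simp
  qed
qed

lemma all_reducible: "reducible_at_descents w"
proof (induction w rule: wf_induct_rule[OF wf_word_order])
  case (1 w)
  show ?case unfolding reducible_at_descents_def
  proof (intro allI impI)
    fix a k j b x assume w: "w = a @ k # j # b" "j < k"
    then have "\<not> sorted w" by (auto simp: sorted_append)
    then obtain a' k' j' b' where w': "w = a' @ k' # j' # b'" "j' < k'"
      "\<And>x. nf w x = nf (a' @ j' # k' # b') x + bracket_term a' k' j' b' x"
      using nf_descent_ex by blast
    show "nf w x = nf (a @ j # k # b) x + bracket_term a k j b x"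
      using descents_confluent[of w, OF 1 w w'(1,2)] descents_confluent[of w, OF 1 w'(1,2) w] w'(3)
      by (metis nat_le_linear)
  qed
qed

text \<open>
Any two neighbouring letters, in descending order or not, satisfy the Virasoro relation once
both sides are brought to normal form.
\<close>

lemma nf_commute:
  "nf (a @ k # j # b) x = nf (a @ j # k # b) x + of_int (k - j) *\<^sub>C nf (a @ (k + j) # b) x
    + cocycle k j *\<^sub>C nf (a @ b) x"
  using reducible_any[of a b k j x] all_reducible by (simp add: bracket_term_def add.assoc)


lemma nf_add: "nf w (x + y) = nf w x + nf w y"
proof (induction w arbitrary: x y rule: wf_induct_rule[OF wf_word_order])
  case (1 w)
  show ?case
  proof (cases w rule: word_cases)
    case normal
    then show ?thesis by (simp add: nf_normal single_add)
  next
    case (last a k)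
    then have "nf a (\<rho> k x + \<rho> k y) = nf a (\<rho> k x) + nf a (\<rho> k y)"
      by (intro 1) (auto intro: word_order_shorter)
    then show ?thesis using last by (simp add: nf_sorted_last rho_add)
  next
    case descent
    then obtain a k j b where w: "w = a @ k # j # b" "j < k" using unsorted_has_descent by blast
    have "nf (a @ j # k # b) (x + y) = nf (a @ j # k # b) x + nf (a @ j # k # b) y"
      "nf (a @ (k + j) # b) (x + y) = nf (a @ (k + j) # b) x + nf (a @ (k + j) # b) y"
      "nf (a @ b) (x + y) = nf (a @ b) x + nf (a @ b) y"
      using w by (auto intro!: 1 word_order_shorter word_order_swap)
    then show ?thesis
      by (simp add: w(1) nf_commute[of a k j b] cscale_add_right)
  qed
qed

lemma nf_cscale: "nf w (c *\<^sub>C x) = c *\<^sub>C nf w x"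
proof (induction w arbitrary: x rule: wf_induct_rule[OF wf_word_order])
  case (1 w)
  show ?case
  proof (cases w rule: word_cases)
    case normal
    then show ?thesis by (simp add: nf_normal)
  next
    case (last a k)
    then have "nf a (c *\<^sub>C \<rho> k x) = c *\<^sub>C nf a (\<rho> k x)"
      by (intro 1) (auto intro: word_order_shorter)
    then show ?thesis using last by (simp add: nf_sorted_last rho_cscale)
  next
    case descent
    then obtain a k j b where w: "w = a @ k # j # b" "j < k" using unsorted_has_descent by blast
    have "nf (a @ j # k # b) (c *\<^sub>C x) = c *\<^sub>C nf (a @ j # k # b) x"
      "nf (a @ (k + j) # b) (c *\<^sub>C x) = c *\<^sub>C nf (a @ (k + j) # b) x"
      "nf (a @ b) (c *\<^sub>C x) = c *\<^sub>C nf (a @ b) x"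
      using w by (auto intro!: 1 word_order_shorter word_order_swap)
    then show ?thesis
      by (simp add: w(1) nf_commute[of a k j b] cscale_add_right cscale_cscale mult.commute)
  qed
qed

lemma cocycle_pos: "0 < k \<Longrightarrow> 0 < j \<Longrightarrow> cocycle k j = 0"
  by (simp add: cocycle_def)

text \<open>
By definition this holds for sorted words. In an unsorted word a descent is exchanged first; if it
involves the last letter \<open>k\<close>, two positive letters \<open>k' > k\<close> stand at the end, and the relation
between \<open>\<rho> k'\<close> and \<open>\<rho> k\<close> in \<open>N\<close> is what makes both computations agree.
\<close>

lemma nf_last: "0 < k \<Longrightarrow> nf (a @ [k]) x = nf a (\<rho> k x)"
proof (induction "a @ [k]" arbitrary: a k x rule: wf_induct_rule[OF wf_word_order])
  case 1
  note IH = 1(1) and k = 1(2)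
  show ?case
  proof (cases "sorted (a @ [k])")
    case True
    then show ?thesis using k by (rule nf_sorted_last)
  next
    case False
    then obtain a' k' j' b' where w: "a @ [k] = a' @ k' # j' # b'" "j' < k'"
      using unsorted_has_descent by blast
    show ?thesis
    proof (cases b' rule: rev_cases)
      case Nil
      then have w': "a = a' @ [k']" "j' = k" using w by auto
      have sw: "(a' @ k # [k'], a @ [k]) \<in> word_order"
        using word_order_swap[of k k' a' "[]"] w w' by simp
      have "0 < k'" using w w' k by simp
      have 2: "nf (a @ [k]) x = nf (a' @ [k, k']) x + of_int (k' - k) *\<^sub>C nf (a' @ [k' + k]) x"
        using nf_commute[of a' k' k "[]" x] w' k \<open>0 < k'\<close> by (simp add: cocycle_pos)
      have 3: "nf (a' @ [k, k']) x = nf a' (\<rho> k (\<rho> k' x))"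
        using IH[of "a' @ [k]" k' x] IH[of a' k "\<rho> k' x"] sw w' k \<open>0 < k'\<close>
        by (simp add: word_order_shorter)
      have 4: "nf (a' @ [k' + k]) x = nf a' (\<rho> (k' + k) x)"
        using IH[of a' "k' + k" x] w' k \<open>0 < k'\<close> by (simp add: word_order_shorter)
      have 5: "nf (a' @ [k']) (\<rho> k x) = nf a' (\<rho> k' (\<rho> k x))"
        using IH[of a' k' "\<rho> k x"] w' \<open>0 < k'\<close> by (simp add: word_order_shorter)
      show ?thesis
        unfolding 2 3 4 unfolding w'(1) 5 rho_commute[OF \<open>0 < k'\<close> k] nf_add nf_cscale ..
    next
      case (snoc b l)
      then have w': "a = a' @ k' # j' # b" "l = k" using w by auto
      have sw: "(a' @ j' # k' # b @ [k], a @ [k]) \<in> word_order"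
        using word_order_swap[of j' k' a' "b @ [k]"] w w' by simp
      show ?thesis
        using nf_commute[of a' k' j' "b @ [k]" x] nf_commute[of a' k' j' b "\<rho> k x"] k
          IH[of "a' @ j' # k' # b" k x] IH[of "a' @ (k' + j') # b" k x]
          IH[of "a' @ b" k x] sw w'
        by (simp add: word_order_shorter)
    qed
  qed
qed


text \<open>
Properties of normal forms are proved by following the rewriting steps. The conclusion of a step
carries the normal form as an explicit combination, so only closure of \<open>Q\<close> under the steps is needed.
\<close>

lemma nf_induct [case_names normal last descent]:
  assumes normal: "\<And>w x. normal_word w \<Longrightarrow> Q w x (Poly_Mapping.single w x)"
    and last: "\<And>a k x p. 0 < k \<Longrightarrow> Q a (\<rho> k x) p \<Longrightarrow> Q (a @ [k]) x p"
    and descent: "\<And>a k j b x p q r. j < k \<Longrightarrow>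
      Q (a @ j # k # b) x p \<Longrightarrow> Q (a @ (k + j) # b) x q \<Longrightarrow> Q (a @ b) x r \<Longrightarrow>
      Q (a @ k # j # b) x (p + of_int (k - j) *\<^sub>C q + cocycle k j *\<^sub>C r)"
  shows "Q w x (nf w x)"
proof (induction w arbitrary: x rule: wf_induct_rule[OF wf_word_order])
  case (1 w)
  show ?case
  proof (cases w rule: word_cases)
    case normal
    then show ?thesis using assms(1) by (simp add: nf_normal)
  next
    case (last a k)
    then have "Q a (\<rho> k x) (nf a (\<rho> k x))"
      by (intro 1) (auto intro: word_order_shorter)
    then show ?thesis using last assms(2) by (simp add: nf_last)
  next
    case descent
    then obtain a k j b where w: "w = a @ k # j # b" "j < k" using unsorted_has_descent by blast
    have "Q (a @ j # k # b) x (nf (a @ j # k # b) x)"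
      "Q (a @ (k + j) # b) x (nf (a @ (k + j) # b) x)"
      "Q (a @ b) x (nf (a @ b) x)"
      using w by (auto intro!: 1 word_order_shorter word_order_swap)
    then show ?thesis using w assms(3) nf_commute[of a k j b x] by simp
  qed
qed

lemma keys_nf: "Poly_Mapping.keys (nf w x) \<subseteq> {u. normal_word u}"
proof (rule nf_induct[of "\<lambda>w x p. Poly_Mapping.keys p \<subseteq> {u. normal_word u}"])
  fix a :: "int list" and k j :: int and b :: "int list" and x :: 'n
    and p q r :: "int list \<Rightarrow>\<^sub>0 'n"
  assume *: "Poly_Mapping.keys p \<subseteq> {u. normal_word u}"
    "Poly_Mapping.keys q \<subseteq> {u. normal_word u}" "Poly_Mapping.keys r \<subseteq> {u. normal_word u}"
  have "Poly_Mapping.keys (p + of_int (k - j) *\<^sub>C q + cocycle k j *\<^sub>C r)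
      \<subseteq> Poly_Mapping.keys p \<union> Poly_Mapping.keys q \<union> Poly_Mapping.keys r"
    by (auto simp: in_keys_iff lookup_add)
  then show "Poly_Mapping.keys (p + of_int (k - j) *\<^sub>C q + cocycle k j *\<^sub>C r)
      \<subseteq> {u. normal_word u}"
    using * by blast
qed auto

text \<open>
Left multiplication by \<open>d\<^sub>k\<close>, followed by normalization. It is defined for combinations of all words,
as is the projection \<open>normalize\<close> onto the combinations of normal words.
\<close>

definition op :: "int \<Rightarrow> (int list \<Rightarrow>\<^sub>0 'n) \<Rightarrow> (int list \<Rightarrow>\<^sub>0 'n)" where
  "op k = lift_sum (\<lambda>w. nf (k # w))"

definition normalize :: "(int list \<Rightarrow>\<^sub>0 'n) \<Rightarrow> (int list \<Rightarrow>\<^sub>0 'n)" where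
  "normalize = lift_sum nf"

lemma op_single [simp]: "op k (Poly_Mapping.single w x) = nf (k # w) x"
  unfolding op_def by (rule lift_sum_single) (rule nf_add)

lemma op_add: "op k (p + q) = op k p + op k q"
  unfolding op_def by (rule lift_sum_add) (rule nf_add)

lemma op_diff: "op k (p - q) = op k p - op k q"
  unfolding op_def by (rule lift_sum_diff) (rule nf_add)

lemma op_zero: "op k 0 = 0"
  by (simp add: op_def)

lemma op_cscale: "op k (c *\<^sub>C p) = c *\<^sub>C op k p"
  unfolding op_def by (rule lift_sum_cscale) (simp_all add: nf_add nf_cscale)

lemma normalize_single [simp]: "normalize (Poly_Mapping.single w x) = nf w x"
  unfolding normalize_def by (rule lift_sum_single) (rule nf_add)

lemma normalize_add: "normalize (p + q) = normalize p + normalize q"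
  unfolding normalize_def by (rule lift_sum_add) (rule nf_add)

lemma normalize_zero: "normalize 0 = 0"
  by (simp add: normalize_def)

lemma normalize_cscale: "normalize (c *\<^sub>C p) = c *\<^sub>C normalize p"
  unfolding normalize_def by (rule lift_sum_cscale) (simp_all add: nf_add nf_cscale)

lemma keys_normalize: "Poly_Mapping.keys (normalize p) \<subseteq> {u. normal_word u}"
proof (induction p rule: poly_mapping_single_induct)
  case (add w x p)
  then show ?case
    using keys_nf[of w x] Poly_Mapping.keys_add[of "nf w x" "normalize p"]
    by (auto simp: normalize_add)
qed (simp add: normalize_zero)

lemma op_nf: "op k (nf w x) = nf (k # w) x"
proof (rule nf_induct[of "\<lambda>w x p. op k p = nf (k # w) x"])
  fix a l x p assume "0 < l" "op k p = nf (k # a) (\<rho> l x)"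
  then show "op k p = nf (k # a @ [l]) x" using nf_last[of l "k # a" x] by simp
next
  fix a l j b x p q r
  assume "op k p = nf (k # a @ j # l # b) x" "op k q = nf (k # a @ (l + j) # b) x"
    "op k r = nf (k # a @ b) x"
  then show "op k (p + of_int (l - j) *\<^sub>C q + cocycle l j *\<^sub>C r) = nf (k # a @ l # j # b) x"
    using nf_commute[of "k # a" l j b x] by (simp add: op_add op_cscale)
qed simp

lemma normalize_nf: "normalize (nf w x) = nf w x"
proof (rule nf_induct[of "\<lambda>w x p. normalize p = nf w x"])
  fix a k j b x p q r
  assume "normalize p = nf (a @ j # k # b) x" "normalize q = nf (a @ (k + j) # b) x"
    "normalize r = nf (a @ b) x"
  then show "normalize (p + of_int (k - j) *\<^sub>C q + cocycle k j *\<^sub>C r) = nf (a @ k # j # b) x"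
    using nf_commute[of a k j b x] by (simp add: normalize_add normalize_cscale)
qed (simp_all add: nf_last)

lemma op_normalize: "op k (normalize p) = op k p"
  by (induction p rule: poly_mapping_single_induct)
    (simp_all add: op_zero normalize_zero op_add normalize_add op_nf)

lemma normalize_op: "normalize (op k p) = op k p"
  by (induction p rule: poly_mapping_single_induct)
    (simp_all add: op_zero normalize_zero op_add normalize_add normalize_nf)

lemma op_commute:
  "op k (op j p) = op j (op k p) + of_int (k - j) *\<^sub>C op (k + j) p + cocycle k j *\<^sub>C normalize p"
proof (induction p rule: poly_mapping_single_induct)
  case (add w x p)
  then show ?case
    using nf_commute[of "[]" k j w x]
    by (simp add: op_add normalize_add op_nf cscale_add_right)
qed (simp add: op_zero normalize_zero)

text \<open>
The letter \<open>z\<close> acts by \<open>\<xi>\<close> times the projection \<open>normalize\<close> instead of by \<open>\<xi>\<close> alone: the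
relation between \<open>d\<^sub>k\<close> and \<open>d\<^sub>-\<^sub>k\<close> then holds on all words, normal or not, and no subtype of normal
combinations has to be introduced.
\<close>

fun index_op :: "vir_index \<Rightarrow> (int list \<Rightarrow>\<^sub>0 'n) \<Rightarrow> (int list \<Rightarrow>\<^sub>0 'n)" where
  "index_op Zi p = \<xi> *\<^sub>C normalize p"
| "index_op (Di k) p = op k p"

definition word_act :: "virasoro \<Rightarrow> (int list \<Rightarrow>\<^sub>0 'n) \<Rightarrow> (int list \<Rightarrow>\<^sub>0 'n)" where
  "word_act x p = lin_ext (\<lambda>i. index_op i p) (vir_coeffs x)"

lemma word_act_d [simp]: "word_act (vir_d k) p = op k p"
  and word_act_z [simp]: "word_act vir_z p = \<xi> *\<^sub>C normalize p"
  and word_act_basis: "word_act (vir_basis i) p = index_op i p"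
  by (simp_all add: word_act_def)

lemma word_act_add_left: "word_act (x + y) p = word_act x p + word_act y p"
  by (simp add: word_act_def vir_coeffs_add lin_ext_add)

lemma word_act_cscale_left: "word_act (c *\<^sub>C x) p = c *\<^sub>C word_act x p"
  by (simp add: word_act_def vir_coeffs_cscale lin_ext_map_scale)

lemma word_act_zero_left: "word_act 0 p = 0"
  using word_act_cscale_left[of 0 0 p] by simp

lemma index_op_add: "index_op i (p + q) = index_op i p + index_op i q"
  by (cases i) (simp_all add: op_add normalize_add cscale_add_right)

lemma index_op_cscale: "index_op i (c *\<^sub>C p) = c *\<^sub>C index_op i p"
  by (cases i) (simp_all add: op_cscale normalize_cscale mult.commute)

lemma word_act_add_right: "word_act x (p + q) = word_act x p + word_act x q"
  by (simp add: word_act_def index_op_add lin_ext_fun_add)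

lemma word_act_cscale_right: "word_act x (c *\<^sub>C p) = c *\<^sub>C word_act x p"
  by (simp add: word_act_def index_op_cscale lin_ext_fun_scale)

lemma index_op_bracket:
  "word_act (bracket (vir_basis i) (vir_basis j)) p =
    index_op i (index_op j p) - index_op j (index_op i p)"
proof (cases i; cases j)
  fix k l assume ij: "i = Di k" "j = Di l"
  have "(if l = - k then (of_int (k ^ 3 - k) / 12 :: complex) *\<^sub>C vir_z else 0)
      = (if l = - k then of_int (k ^ 3 - k) / 12 else 0) *\<^sub>C vir_z" by simp
  then show ?thesis
    unfolding ij vir_bracket_basis vir_basis_bracket.simps word_act_add_left
      word_act_cscale_left word_act_d
    using op_commute[of k l p]
    by (simp add: word_act_cscale_left cocycle_def word_act_zero_left)
qed (simp_all add: vir_bracket_z word_act_zero_left op_cscale op_normalize normalize_op)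

sublocale word: lie_module word_act
proof
  fix x y p
  have 1: "word_act (bracket (vir_basis i) y) p =
      word_act (vir_basis i) (word_act y p) - word_act y (word_act (vir_basis i) p)" for i
    by (induction y rule: vir_induct)
      (simp_all add: word_act_basis index_op_bracket bracket_add_right bracket_cscale_right
        word_act_add_left word_act_cscale_left index_op_add index_op_cscale
        cvec.scale_right_diff_distrib)
  show "word_act (bracket x y) p = word_act x (word_act y p) - word_act y (word_act x p)"
    by (induction x rule: vir_induct)
      (simp_all add: 1 bracket_add_left bracket_cscale_left word_act_add_left
        word_act_cscale_left word_act_add_right word_act_cscale_right
        cvec.scale_right_diff_distrib)
qed (rule word_act_add_left word_act_add_right word_act_cscale_left word_act_cscale_right)+

end


section \<open>Maps out of the induced module\<close>

lemma uea_induct [case_names const gen add mult]: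
  fixes u :: "'g::lie_algebra uea"
  assumes const: "\<And>c. P (uea_const c)" and gen: "\<And>x. P (uea_gen x)"
    and add: "\<And>u v. P u \<Longrightarrow> P v \<Longrightarrow> P (u + v)" and mult: "\<And>u v. P u \<Longrightarrow> P v \<Longrightarrow> P (u * v)"
  shows "P u"
proof -
  have "P (abs_uea a)" for a
  proof (induction a rule: poly_mapping_add_induct)
    case (single w c)
    have "P (abs_uea (Poly_Mapping.single (Word xs) c))" for xs
    proof (induction xs)
      case Nil
      show ?case using const[of c] by (simp add: uea_const.abs_eq fa_const_def zero_word_def)
    next
      case (Cons x xs)
      have "abs_uea (Poly_Mapping.single (Word (x # xs)) c)
          = uea_gen x * abs_uea (Poly_Mapping.single (Word xs) c)"
        by (simp add: uea_gen.abs_eq times_uea.abs_eq fa_gen_def mult_single plus_word_def)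
      then show ?case using gen mult Cons by simp
    qed
    then show ?case by (cases w) simp
  next
    case (add a b)
    then show ?case using assms(3) by (simp add: plus_uea.abs_eq[symmetric])
  qed
  then show ?thesis by (cases u rule: uea_cases) simp
qed

context lie_module
begin

lemma act_zero_right: "act x 0 = 0"
  using act_cscale_right[of x 0 0] by simp

lemma uea_act_add_left: "uea_act act (u + u') a = uea_act act u a + uea_act act u' a"
  by (cases u rule: uea_cases, cases u' rule: uea_cases)
    (simp add: plus_uea.abs_eq uea_act_abs fa_act_add_left)

lemma uea_act_mult: "uea_act act (u * u') a = uea_act act u (uea_act act u' a)"
  by (cases u rule: uea_cases, cases u' rule: uea_cases)
    (simp add: times_uea.abs_eq uea_act_abs fa_act_mult)

lemma uea_act_add_right: "uea_act act u (a + b) = uea_act act u a + uea_act act u b"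
  by (cases u rule: uea_cases) (simp add: uea_act_abs fa_act_add_right)

end

lemma module_hom_uea_act:
  assumes "lie_module act" "lie_module act'"
    and "\<And>a b. f (a + b) = f a + f b" and "\<And>c a. f (c *\<^sub>C a) = c *\<^sub>C f a"
    and "\<And>x a. f (act x a) = act' x (f a)"
  shows "f (uea_act act u a) = uea_act act' u (f a)"
proof (induction u arbitrary: a rule: uea_induct)
qed (simp_all add: assms lie_module.uea_act_const lie_module.uea_act_gen
    lie_module.uea_act_add_left lie_module.uea_act_mult)

lemma uea_act_incl:
  assumes "lie_module act"
    and "\<And>a b. \<iota> (a + b) = \<iota> a + \<iota> b" and "\<And>c a. \<iota> (c *\<^sub>C a) = c *\<^sub>C \<iota> a"
    and "\<And>x a. \<iota> (zn_act x a) = act (of_zn x) (\<iota> a)"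
  shows "uea_act act (uea_incl t) (\<iota> a) = \<iota> (uea_act zn_act t a)"
proof (induction t arbitrary: a rule: uea_induct)
qed (simp_all add: assms uea_incl_const uea_incl_gen uea_incl_add uea_incl_mult
    lie_module.uea_act_const lie_module.uea_act_gen lie_module.uea_act_add_left
    lie_module.uea_act_mult zn_lie_module)

lemma uea_act_ind_act: "uea_act ind_act u a = ind_lmult u a"
  by (induction u arbitrary: a rule: uea_induct)
    (simp_all add: ind_module.uea_act_const ind_module.uea_act_gen ind_module.uea_act_add_left
      ind_module.uea_act_mult ind_act_def ind_lmult_plus ind_lmult_mult cscale_induced_def)

text \<open>
Frobenius reciprocity: a homomorphism \<open>\<iota>\<close> from \<open>N\<close> to a \<open>\<gg>\<close>-module, over \<open>\<complex>z \<oplus> \<nn>\<^sup>+\<close>,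
extends to the induced module by \<open>u \<otimes> n \<mapsto> u (\<iota> n)\<close>.
\<close>

lemma induced_universal:
  fixes act :: "virasoro \<Rightarrow> 'p::complex_vec \<Rightarrow> 'p" and \<iota> :: "'n::zn_module \<Rightarrow> 'p"
  assumes "lie_module act"
    and \<iota>: "\<And>a b. \<iota> (a + b) = \<iota> a + \<iota> b" "\<And>c a. \<iota> (c *\<^sub>C a) = c *\<^sub>C \<iota> a"
      "\<And>x a. \<iota> (zn_act x a) = act (of_zn x) (\<iota> a)"
  obtains \<Phi> :: "'n induced \<Rightarrow> 'p" where
    "\<And>a b. \<Phi> (a - b) = \<Phi> a - \<Phi> b" "\<And>u n. \<Phi> (ind_tensor u n) = uea_act act u (\<iota> n)"
proof -
  interpret lie_module act by fact
  define f where "f = (\<lambda>(u, n) (i::int). of_int i *\<^sub>C uea_act act u (\<iota> n))"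
  have f_add: "f k (i + j) = f k i + f k j" for k i j
    by (cases k) (simp add: f_def cscale_add_left)
  define F where "F = lift_sum f"
  have F_diff: "F (a - b) = F a - F b" for a b
    unfolding F_def by (rule lift_sum_diff) (rule f_add)
  have F_of: "F (frag_of (u, n)) = uea_act act u (\<iota> n)" for u n
    unfolding F_def using f_add by (subst lift_sum_single) (simp_all add: f_def)
  have rel: "F a = 0" if "a \<in> ind_rel" for a
    using that unfolding ind_rel_def
  proof (induction a rule: tensor_rel.induct)
    case zero
    then show ?case by (simp add: F_def)
  next
    case (balanced u t n)
    show ?case
      by (simp add: F_diff F_of uea_act_mult uea_act_incl[OF assms(1) \<iota>])
  qed (simp_all add: F_diff F_of \<iota> uea_act_add_left uea_act_add_right)
  define \<Phi> where "\<Phi> a = F (rep_induced a)" for a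
  have \<Phi>_abs: "\<Phi> (abs_induced c) = F c" for c
  proof -
    have "rep_induced (abs_induced c) - c \<in> ind_rel"
      using Quotient3_abs_rep[OF Quotient3_induced] by (metis abs_induced_eq_iff)
    from rel[OF this] show ?thesis by (simp add: \<Phi>_def F_diff)
  qed
  show thesis
  proof (rule that[of \<Phi>])
    show "\<Phi> (a - b) = \<Phi> a - \<Phi> b" for a b
      by (cases a rule: induced_cases, cases b rule: induced_cases)
        (simp add: minus_induced.abs_eq \<Phi>_abs F_diff)
    show "\<Phi> (ind_tensor u n) = uea_act act u (\<iota> n)" for u n
      by (simp add: ind_tensor_def \<Phi>_abs F_of)
  qed
qed

definition d_act :: "int \<Rightarrow> 'n::zn_module \<Rightarrow> 'n" where
  "d_act k = zn_act (to_zn (vir_d k))"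

lemma vir_d_in_zn: "0 < k \<Longrightarrow> vir_d k \<in> vir_zn_set"
  by (auto simp: vir_zn_set_def intro: cvec.span_base)

lemma bracket_to_zn_d:
  assumes "0 < k" "0 < j"
  shows "bracket (to_zn (vir_d k)) (to_zn (vir_d j)) = of_int (k - j) *\<^sub>C to_zn (vir_d (k + j))"
proof -
  have "of_zn (bracket (to_zn (vir_d k)) (to_zn (vir_d j)))
      = of_zn (of_int (k - j) *\<^sub>C to_zn (vir_d (k + j)))"
    using assms
    by (simp add: bracket_vir_zn.rep_eq cscale_vir_zn.rep_eq of_zn_to_zn vir_d_in_zn vir_bracket_dd)
  then show ?thesis by (simp only: of_zn_inject)
qed

lemma positive_module_d_act: "positive_module d_act"
proof
  fix k j :: int and x :: 'a assume kj: "0 < k" "0 < j"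
  show "d_act k (d_act j x) = d_act j (d_act k x) + of_int (k - j) *\<^sub>C d_act (k + j) x"
    using zn_act_bracket[of "to_zn (vir_d k)" "to_zn (vir_d j)" x]
    unfolding bracket_to_zn_d[OF kj] by (simp add: d_act_def zn_act_cscale_left)
qed (simp_all add: d_act_def zn_act_add_right zn_act_cscale_right)

text \<open>
Interpreting words in the induced module itself, the word \<open>k\<^sub>1 \<dots> k\<^sub>r\<close> with coefficient \<open>x\<close> becomes
\<open>d\<^sub>k\<^sub>1 \<dots> d\<^sub>k\<^sub>r \<otimes> x\<close>. Rewriting to normal form does not change this vector, since each step is an
identity in the induced module.
\<close>

definition word_vector :: "int list \<Rightarrow> 'n::zn_module \<Rightarrow> 'n induced" where
  "word_vector w x = foldr (\<lambda>k. ind_act (vir_d k)) w (ind_tensor 1 x)"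

lemma ind_act_foldr_add:
  "foldr (\<lambda>k. ind_act (vir_d k)) w (x + y) =
    foldr (\<lambda>k. ind_act (vir_d k)) w x + foldr (\<lambda>k. ind_act (vir_d k)) w y"
  by (induction w) (simp_all add: ind_module.act_add_right)

lemma ind_act_foldr_cscale:
  "foldr (\<lambda>k. ind_act (vir_d k)) w (c *\<^sub>C x) = c *\<^sub>C foldr (\<lambda>k. ind_act (vir_d k)) w x"
  by (induction w) (simp_all add: ind_module.act_cscale_right)

lemma word_vector_add: "word_vector w (x + y) = word_vector w x + word_vector w y"
  by (simp add: word_vector_def ind_tensor_add_right ind_act_foldr_add)

lemma word_vector_cscale: "word_vector w (c *\<^sub>C x) = c *\<^sub>C word_vector w x"
  by (simp add: word_vector_def ind_tensor_cscale_right ind_act_foldr_cscale)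

lemma word_vector_Cons: "word_vector (k # w) x = ind_act (vir_d k) (word_vector w x)"
  by (simp add: word_vector_def)

definition evaluate :: "(int list \<Rightarrow>\<^sub>0 'n::zn_module) \<Rightarrow> 'n induced" where
  "evaluate = lift_sum word_vector"

lemma evaluate_single [simp]: "evaluate (Poly_Mapping.single w x) = word_vector w x"
  unfolding evaluate_def by (rule lift_sum_single) (rule word_vector_add)

lemma evaluate_add: "evaluate (p + q) = evaluate p + evaluate q"
  unfolding evaluate_def by (rule lift_sum_add) (rule word_vector_add)

lemma evaluate_cscale: "evaluate (c *\<^sub>C p) = c *\<^sub>C evaluate p"
  unfolding evaluate_def by (rule lift_sum_cscale) (simp_all add: word_vector_add word_vector_cscale)

lemma evaluate_zero: "evaluate 0 = 0"
  by (simp add: evaluate_def)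

lemma word_vector_last:
  assumes "0 < k"
  shows "word_vector (a @ [k]) x = word_vector a (d_act k x)"
  using ind_act_one_tensor[of "to_zn (vir_d k)" x] vir_d_in_zn[OF assms]
  by (simp add: word_vector_def d_act_def of_zn_to_zn)

lemma central_word_vector:
  assumes "\<And>x :: 'n::zn_module. zn_act (to_zn vir_z) x = \<xi> *\<^sub>C x"
  shows "ind_act vir_z (word_vector w (x :: 'n)) = \<xi> *\<^sub>C word_vector w x"
proof (induction w)
  case Nil
  show ?case
    using ind_act_one_tensor[of "to_zn vir_z" x] assms
    by (simp add: word_vector_def vir_z_in_zn of_zn_to_zn ind_tensor_cscale_right)
next
  case (Cons k w)
  have "ind_act 0 b = 0" for b :: "'n induced"
    using ind_module.act_cscale_left[of 0 0 b] by simp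
  then have "ind_act vir_z (ind_act (vir_d k) b) = ind_act (vir_d k) (ind_act vir_z b)"
    for b :: "'n induced"
    using ind_module.act_bracket[of vir_z "vir_d k" b] by (simp add: vir_bracket_z)
  then show ?case using Cons by (simp add: word_vector_Cons ind_module.act_cscale_right)
qed

lemma word_vector_commute:
  assumes "\<And>x :: 'n::zn_module. zn_act (to_zn vir_z) x = \<xi> *\<^sub>C x"
  shows "word_vector (a @ k # j # b) (x :: 'n) = word_vector (a @ j # k # b) x
    + of_int (k - j) *\<^sub>C word_vector (a @ (k + j) # b) x
    + positive_module.cocycle \<xi> k j *\<^sub>C word_vector (a @ b) x"
proof -
  let ?v = "word_vector b x"
  interpret positive_module d_act \<xi> by (rule positive_module_d_act)
  have z: "ind_act ((if j = - k then (of_int (k ^ 3 - k) / 12) *\<^sub>C vir_z else 0) :: virasoro) ?v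
      = cocycle k j *\<^sub>C ?v"
    using central_word_vector[OF assms, of b x] ind_module.act_cscale_left[of 0 0 ?v]
    by (simp add: cocycle_def ind_module.act_cscale_left)
  have "ind_act (vir_d k) (ind_act (vir_d j) ?v) = ind_act (vir_d j) (ind_act (vir_d k) ?v)
      + of_int (k - j) *\<^sub>C ind_act (vir_d (k + j)) ?v + cocycle k j *\<^sub>C ?v"
    using ind_module.act_bracket[of "vir_d k" "vir_d j" ?v]
    unfolding vir_bracket_dd vir_basis_bracket.simps ind_module.act_add_left
      ind_module.act_cscale_left z
    by (simp add: algebra_simps)
  then show ?thesis
    by (simp add: word_vector_def ind_act_foldr_add ind_act_foldr_cscale)
qed


lemma to_zn_linear:
  assumes "x \<in> vir_zn_set" "y \<in> vir_zn_set"
  shows "to_zn (c *\<^sub>C x + y) = c *\<^sub>C to_zn x + to_zn y"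
proof -
  have "c *\<^sub>C x + y \<in> vir_zn_set"
    using assms unfolding vir_zn_set_def by (simp add: cvec.span_add cvec.span_scale)
  then have "of_zn (to_zn (c *\<^sub>C x + y)) = of_zn (c *\<^sub>C to_zn x + to_zn y)"
    using assms by (simp add: of_zn_to_zn plus_vir_zn.rep_eq cscale_vir_zn.rep_eq)
  then show ?thesis by (simp only: of_zn_inject)
qed

context
  fixes \<xi> :: complex
  assumes z_act: "\<And>x :: 'n::zn_module. zn_act (to_zn vir_z) x = \<xi> *\<^sub>C x"
begin

interpretation positive_module "d_act :: int \<Rightarrow> 'n \<Rightarrow> 'n" \<xi>
  by (rule positive_module_d_act)

lemma evaluate_nf: "evaluate (nf w (x :: 'n)) = word_vector w x"
proof (rule nf_induct[of "\<lambda>w x p. evaluate p = word_vector w x"])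
  fix a k j b and x :: 'n and p q r
  assume "evaluate p = word_vector (a @ j # k # b) x"
    "evaluate q = word_vector (a @ (k + j) # b) x" "evaluate r = word_vector (a @ b) x"
  then show "evaluate (p + of_int (k - j) *\<^sub>C q + cocycle k j *\<^sub>C r)
      = word_vector (a @ k # j # b) x"
    using word_vector_commute[OF z_act, of a k j b x] by (simp add: evaluate_add evaluate_cscale)
qed (simp_all add: word_vector_last)

lemma evaluate_op: "evaluate (op k p) = ind_act (vir_d k) (evaluate p)"
  by (induction p rule: poly_mapping_single_induct)
    (simp_all add: op_zero evaluate_zero op_add evaluate_add evaluate_nf word_vector_Cons
      ind_module.act_add_right ind_module.act_zero_right)

lemma evaluate_normalize: "evaluate (normalize p) = evaluate p"
  by (induction p rule: poly_mapping_single_induct)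
    (simp_all add: normalize_zero normalize_add evaluate_add evaluate_nf)

lemma evaluate_central: "ind_act vir_z (evaluate p) = \<xi> *\<^sub>C evaluate (p :: int list \<Rightarrow>\<^sub>0 'n)"
  by (induction p rule: poly_mapping_single_induct)
    (simp_all add: evaluate_zero evaluate_add central_word_vector[OF z_act]
      ind_module.act_add_right ind_module.act_zero_right cscale_add_right)

lemma evaluate_word_act: "evaluate (word_act x p) = ind_act x (evaluate p)"
proof (induction x rule: vir_induct)
  case (basis i)
  show ?case
    by (cases i) (simp_all add: evaluate_op evaluate_cscale evaluate_normalize evaluate_central)
qed (simp_all add: word_act_add_left word_act_cscale_left evaluate_add evaluate_cscale
    ind_module.act_add_left ind_module.act_cscale_left)

lemma word_act_empty_word:
  fixes n :: 'n
  shows "word_act (of_zn x) (Poly_Mapping.single [] n) = Poly_Mapping.single [] (zn_act x n)"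
proof -
  have "y \<in> vir_zn_set \<and> word_act y (Poly_Mapping.single [] n)
      = Poly_Mapping.single [] (zn_act (to_zn y) n)" if "y \<in> vir_zn_set" for y
    using that unfolding vir_zn_set_def
  proof (induction y rule: cvec.span_induct_alt)
    case base
    have "zn_act (to_zn 0) n = 0"
      using zn_act_cscale_left[of 0 0 n] by (simp add: zero_vir_zn_def)
    then show ?case by (simp add: word_act_zero_left cvec.span_zero)
  next
    case (step c b y)
    have b: "b \<in> vir_zn_set" using step(1) by (simp add: vir_zn_set_def cvec.span_base)
    have y: "y \<in> vir_zn_set" using step by (simp add: vir_zn_set_def)
    have "word_act b (Poly_Mapping.single [] n) = Poly_Mapping.single [] (zn_act (to_zn b) n)"
      using step(1) nf_last[of _ "[]" n] nf_normal[of "[]"]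
      by (auto simp: z_act d_act_def normal_word_def)
    moreover have "c *\<^sub>C b + y \<in> vir_zn_set"
      using b y unfolding vir_zn_set_def by (simp add: cvec.span_add cvec.span_scale)
    ultimately show ?case
      using step b y
      by (simp add: to_zn_linear word_act_add_left word_act_cscale_left zn_act_add_left
          zn_act_cscale_left single_add vir_zn_set_def)
  qed
  from this[OF of_zn] show ?thesis by (simp add: of_zn_inverse)
qed

text \<open>
The homomorphism \<open>\<Phi>\<close> comes from Frobenius reciprocity for \<open>n \<mapsto> 1 \<otimes> n\<close>, and \<open>evaluate\<close> is a left inverse
because it is a homomorphism too and both fix the generators \<open>1 \<otimes> n\<close>.
\<close>

lemma induced_realization:
  obtains \<Phi> :: "'n induced \<Rightarrow> (int list \<Rightarrow>\<^sub>0 'n)" where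
    "\<And>x w. \<Phi> (ind_act x w) = word_act x (\<Phi> w)" "\<And>c w. \<Phi> (c *\<^sub>C w) = c *\<^sub>C \<Phi> w"
    "\<And>w. evaluate (\<Phi> w) = w"
proof -
  let ?\<iota> = "Poly_Mapping.single [] :: 'n \<Rightarrow> _"
  obtain \<Phi> :: "'n induced \<Rightarrow> (int list \<Rightarrow>\<^sub>0 'n)" where
    \<Phi>: "\<And>a b. \<Phi> (a - b) = \<Phi> a - \<Phi> b" "\<And>u n. \<Phi> (ind_tensor u n) = uea_act word_act u (?\<iota> n)"
    by (rule induced_universal[OF word.lie_module_axioms, of ?\<iota>])
      (simp add: single_add, simp, simp add: word_act_empty_word, blast)
  have \<Phi>0: "\<Phi> 0 = 0" using \<Phi>(1)[of 0 0] by simp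
  have lmult: "\<Phi> (ind_lmult u w) = uea_act word_act u (\<Phi> w)" for u w
  proof (induction w rule: induced_induct)
    case zero
    then show ?case
      using word.uea_act_add_right[of u 0 0] by (simp add: ind_lmult_0 \<Phi>0)
  next
    case (diff a b)
    have "uea_act word_act u (\<Phi> a) = uea_act word_act u (\<Phi> a - \<Phi> b) + uea_act word_act u (\<Phi> b)"
      by (simp flip: word.uea_act_add_right)
    then show ?case using diff by (simp add: ind_lmult_diff \<Phi>)
  qed (simp add: ind_lmult_tensor \<Phi> word.uea_act_mult)
  show thesis
  proof (rule that[of \<Phi>])
    show "\<Phi> (ind_act x w) = word_act x (\<Phi> w)" for x w
      by (simp add: ind_act_def lmult word.uea_act_gen)
    show "\<Phi> (c *\<^sub>C w) = c *\<^sub>C \<Phi> w" for c w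
      by (simp add: cscale_induced_def lmult word.uea_act_const)
    show "evaluate (\<Phi> w) = w" for w
    proof (induction w rule: induced_induct)
      case (tensor u n)
      have "evaluate (uea_act word_act u (?\<iota> n)) = uea_act ind_act u (evaluate (?\<iota> n))"
        by (rule module_hom_uea_act)
          (simp_all add: word.lie_module_axioms ind_module.lie_module_axioms evaluate_add
            evaluate_cscale evaluate_word_act)
      then show ?case
        by (simp add: \<Phi> uea_act_ind_act word_vector_def ind_lmult_tensor)
    next
      case (diff a b)
      then show ?case
        using evaluate_add[of "\<Phi> a - \<Phi> b" "\<Phi> b"] by (simp add: \<Phi> eq_diff_eq)
    qed (simp add: \<Phi>0 evaluate_zero)
  qed
qed

lemma whittaker_vector_representative:
  assumes "w \<in> whittaker_vectors (ind_act :: virasoro \<Rightarrow> 'n induced \<Rightarrow> _) \<psi>"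
  obtains p where "evaluate p = w" "Poly_Mapping.keys p \<subseteq> {u. normal_word u}"
    "\<And>k. 0 < k \<Longrightarrow> op k p = \<psi> (vir_d k) *\<^sub>C p"
proof -
  obtain \<Phi> :: "'n induced \<Rightarrow> (int list \<Rightarrow>\<^sub>0 'n)" where
    \<Phi>: "\<And>x w. \<Phi> (ind_act x w) = word_act x (\<Phi> w)" "\<And>c w. \<Phi> (c *\<^sub>C w) = c *\<^sub>C \<Phi> w"
    "\<And>w. evaluate (\<Phi> w) = w"
    using induced_realization by blast
  show thesis
  proof (rule that[of "normalize (\<Phi> w)"])
    show "evaluate (normalize (\<Phi> w)) = w" by (simp add: evaluate_normalize \<Phi>)
    show "Poly_Mapping.keys (normalize (\<Phi> w)) \<subseteq> {u. normal_word u}" by (rule keys_normalize)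
    fix k :: int assume "0 < k"
    then have "vir_d k \<in> nplus" unfolding nplus_def by (auto intro: cvec.span_base)
    then have "ind_act (vir_d k) w = \<psi> (vir_d k) *\<^sub>C w"
      using assms by (auto simp: whittaker_vectors_def)
    then have "op k (\<Phi> w) = \<psi> (vir_d k) *\<^sub>C \<Phi> w" by (metis \<Phi>(1,2) word_act_d)
    then have "normalize (op k (\<Phi> w)) = normalize (\<psi> (vir_d k) *\<^sub>C \<Phi> w)" by (rule arg_cong)
    then show "op k (normalize (\<Phi> w)) = \<psi> (vir_d k) *\<^sub>C normalize (\<Phi> w)"
      by (simp add: op_normalize normalize_op normalize_cscale)
  qed
qed

end


section \<open>Leading terms in the rank one module\<close>

text \<open>
The weight of the letter \<open>d\<^sub>-\<^sub>r\<close> is \<open>r + 1\<close>. The summand \<open>1\<close> makes the weight drop by \<open>1\<close> when two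
letters are replaced by their bracket. It also makes the word obtained from \<open>w\<close> by deleting \<open>d\<^sub>2\<^sub>-\<^sub>k\<close> heavier
than all other words that \<open>d\<^sub>k - \<chi> k\<close> produces from \<open>w\<close>.
\<close>

definition weight :: "int list \<Rightarrow> int" where
  "weight w = sum_list (map (\<lambda>k. 1 - k) w)"

lemma weight_simps [simp]:
  "weight [] = 0" "weight (k # w) = 1 - k + weight w" "weight (a @ b) = weight a + weight b"
  by (simp_all add: weight_def)

lemma weight_remove1: "k \<in> set w \<Longrightarrow> weight (remove1 k w) = weight w - (1 - k)"
  by (induction w) auto

lemma weight_pos: "normal_word w \<Longrightarrow> w \<noteq> [] \<Longrightarrow> 1 \<le> weight w"
proof (induction w)
  case (Cons k w)
  have "0 \<le> weight w"
    using Cons by (cases "w = []") (auto simp: normal_word_def)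
  then show ?case using Cons by (auto simp: normal_word_def)
qed simp

definition filtration :: "int \<Rightarrow> (int list \<Rightarrow>\<^sub>0 complex) set" where
  "filtration D = {p. \<forall>w\<in>Poly_Mapping.keys p. normal_word w \<and> weight w \<le> D}"

lemma filtration_zero [simp]: "0 \<in> filtration D"
  by (simp add: filtration_def)

lemma filtration_add: "p \<in> filtration D \<Longrightarrow> q \<in> filtration D \<Longrightarrow> p + q \<in> filtration D"
  using Poly_Mapping.keys_add[of p q] by (auto simp: filtration_def)

lemma filtration_cscale: "p \<in> filtration D \<Longrightarrow> c *\<^sub>C p \<in> filtration D"
  using keys_cscale[of c p] by (auto simp: filtration_def)

lemma filtration_sum: "(\<And>i. i \<in> S \<Longrightarrow> f i \<in> filtration D) \<Longrightarrow> sum f S \<in> filtration D"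
  by (induction S rule: infinite_finite_induct) (simp_all add: filtration_add)

lemma filtration_mono: "p \<in> filtration D \<Longrightarrow> D \<le> E \<Longrightarrow> p \<in> filtration E"
  by (force simp: filtration_def)

lemma filtration_single:
  "normal_word w \<Longrightarrow> weight w \<le> D \<Longrightarrow> Poly_Mapping.single w x \<in> filtration D"
  by (simp add: filtration_def)

lemma lookup_filtration: "p \<in> filtration D \<Longrightarrow> D < weight w \<Longrightarrow> Poly_Mapping.lookup p w = 0"
  by (force simp: filtration_def in_keys_iff)

text \<open>
The case \<open>N = \<complex>\<close> with \<open>d\<^sub>k\<close> acting by \<open>\<chi> k\<close>.
\<close>

locale whittaker_character =
  fixes \<chi> :: "int \<Rightarrow> complex" and \<xi> :: complex
  assumes chi_2: "\<chi> 2 \<noteq> 0" and chi_ge_3: "3 \<le> k \<Longrightarrow> \<chi> k = 0"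
begin

sublocale positive_module "\<lambda>k x. \<chi> k * x" \<xi>
proof
  fix k j :: int and x :: complex assume "0 < k" "0 < j"
  then have "k = j \<or> 3 \<le> k + j" by auto
  then show "\<chi> k * (\<chi> j * x) = \<chi> j * (\<chi> k * x) + of_int (k - j) *\<^sub>C (\<chi> (k + j) * x)"
    by (auto simp: chi_ge_3 cscale_complex_def)
qed (simp_all add: cscale_complex_def algebra_simps)

text \<open>
An exchange of letters preserves the weight, and a bracket of two letters \<open>\<le> 0\<close> lowers it by \<open>1\<close>.
\<close>

lemma nf_filtration:
  assumes "\<forall>k\<in>set w. k \<le> 0"
  shows "nf w x \<in> filtration (weight w)"
proof -
  have "(\<forall>k\<in>set w. k \<le> 0) \<longrightarrow> nf w x \<in> filtration (weight w)"
  proof (rule nf_induct[of "\<lambda>w x p. (\<forall>k\<in>set w. k \<le> 0) \<longrightarrow> p \<in> filtration (weight w)"])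
    fix a k j b x p q r
    assume jk: "j < k"
      and IH: "(\<forall>k\<in>set (a @ j # k # b). k \<le> 0) \<longrightarrow> p \<in> filtration (weight (a @ j # k # b))"
      "(\<forall>k\<in>set (a @ (k + j) # b). k \<le> 0) \<longrightarrow> q \<in> filtration (weight (a @ (k + j) # b))"
      "(\<forall>k\<in>set (a @ b). k \<le> 0) \<longrightarrow> r \<in> filtration (weight (a @ b))"
    show "(\<forall>k\<in>set (a @ k # j # b). k \<le> 0) \<longrightarrow>
        p + of_int (k - j) *\<^sub>C q + cocycle k j *\<^sub>C r \<in> filtration (weight (a @ k # j # b))"
    proof
      assume neg: "\<forall>k\<in>set (a @ k # j # b). k \<le> 0"
      let ?F = "filtration (weight (a @ k # j # b))"
      have "p \<in> ?F" using IH(1) neg by (auto elim: filtration_mono)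
      moreover have "q \<in> ?F" using IH(2) neg by (auto elim: filtration_mono)
      moreover have "r \<in> ?F" using IH(3) neg by (auto elim!: filtration_mono)
      ultimately show "p + of_int (k - j) *\<^sub>C q + cocycle k j *\<^sub>C r \<in> ?F"
        by (intro filtration_add filtration_cscale)
    qed
  qed (auto intro: filtration_single)
  with assms show ?thesis by blast
qed

lemma op_filtration:
  assumes "j \<le> 0" "p \<in> filtration D"
  shows "op j p \<in> filtration (D + 1 - j)"
  unfolding op_def lift_sum_def
proof (rule filtration_sum)
  fix w assume "w \<in> Poly_Mapping.keys p"
  then have w: "normal_word w" "weight w \<le> D" using assms by (auto simp: filtration_def)
  have "nf (j # w) (Poly_Mapping.lookup p w) \<in> filtration (weight (j # w))"
    using w assms by (intro nf_filtration) (auto simp: normal_word_def)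
  then show "nf (j # w) (Poly_Mapping.lookup p w) \<in> filtration (D + 1 - j)"
    by (rule filtration_mono) (use w in simp)
qed

text \<open>
Whittaker vectors of type \<open>\<chi>\<close> are the common zeros of these operators.
\<close>

definition defect :: "int \<Rightarrow> (int list \<Rightarrow>\<^sub>0 complex) \<Rightarrow> (int list \<Rightarrow>\<^sub>0 complex)" where
  "defect k p = op k p - \<chi> k *\<^sub>C p"

lemma defect_add: "defect k (p + q) = defect k p + defect k q"
  by (simp add: defect_def op_add cscale_add_right)

lemma defect_zero: "defect k 0 = 0"
  by (simp add: defect_def op_zero)

lemma defect_sum: "defect k (sum f S) = (\<Sum>i\<in>S. defect k (f i))"
  by (induction S rule: infinite_finite_induct) (simp_all add: defect_add defect_zero)

text \<open>
The derivative of the monomial \<open>w\<close> with respect to the variable \<open>d\<^sub>2\<^sub>-\<^sub>k\<close>, times \<open>2 (k - 1) \<chi> 2\<close>. For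
\<open>k = 1\<close> it is zero.
\<close>

definition symbol :: "int \<Rightarrow> int list \<Rightarrow> complex \<Rightarrow> (int list \<Rightarrow>\<^sub>0 complex)" where
  "symbol k w x = Poly_Mapping.single (remove1 (2 - k) w)
     (2 * of_int (k - 1) * \<chi> 2 * of_nat (count_list w (2 - k)) * x)"

lemma symbol_filtration:
  assumes "normal_word w"
  shows "symbol k w x \<in> filtration (weight w - k + 1)"
proof (cases "2 - k \<in> set w")
  case True
  then show ?thesis
    using assms by (auto simp: symbol_def weight_remove1 intro!: filtration_single normal_remove1)
next
  case False
  then show ?thesis by (simp add: symbol_def count_list_0_iff)
qed

text \<open>
Induction on \<open>w = j m\<close>, using \<open>d\<^sub>k d\<^sub>j = d\<^sub>j d\<^sub>k + (k - j) d\<^sub>k\<^sub>+\<^sub>j\<close> plus a central term. The operator \<open>d\<^sub>j\<close> extends the statement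
for \<open>m\<close>. If \<open>k + j > 0\<close>, the bracket acts on \<open>m\<close> by the scalar \<open>\<chi> (k + j)\<close> up to its defect, which has small
weight by induction. By weight only the case \<open>k + j = 2\<close> matters, and it accounts for the occurrence of \<open>2 - k\<close> at the
head of \<open>w\<close>.
\<close>

theorem defect_leading_term:
  assumes "normal_word w" "1 \<le> k"
  shows "defect k (Poly_Mapping.single w x) - symbol k w x \<in> filtration (weight w - k)"
  using assms
proof (induction w arbitrary: k)
  case Nil
  then show ?case
    using nf_last[of k "[]" x] by (simp add: defect_def symbol_def nf_normal cscale_complex_def)
next
  case (Cons j m)
  then have j: "j \<le> 0" "\<forall>l\<in>set m. j \<le> l" "normal_word m" by (simp_all add: normal_Cons)
  let ?s = "\<lambda>w. Poly_Mapping.single w x"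
  have coarse: "defect l (?s m) \<in> filtration (weight m - l + 1)" if "1 \<le> l" for l
  proof -
    have "(defect l (?s m) - symbol l m x) + symbol l m x \<in> filtration (weight m - l + 1)"
      using Cons.IH[OF j(3) that] symbol_filtration[OF j(3)]
      by (intro filtration_add) (auto elim: filtration_mono)
    then show ?thesis by simp
  qed
  define X where "X = defect k (?s m) - symbol k m x"
  have opj: "op j (Poly_Mapping.single u y) = Poly_Mapping.single (j # u) y"
    if "normal_word u" "\<forall>l\<in>set u. j \<le> l" for u y
    using that j by (simp add: nf_normal normal_Cons)
  have rem: "\<forall>l\<in>set (remove1 i m). j \<le> l" for i
    using j(2) by (meson notin_set_remove1)
  have "op k (?s (j # m)) = op j (op k (?s m)) + of_int (k - j) *\<^sub>C nf ((k + j) # m) x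
      + cocycle k j *\<^sub>C ?s m"
    using nf_commute[of "[]" k j m x] j(3) by (simp add: op_nf nf_normal)
  also have "op k (?s m) = X + symbol k m x + \<chi> k *\<^sub>C ?s m"
    by (simp add: X_def defect_def)
  also have "op j \<dots> = op j X + op j (symbol k m x) + \<chi> k *\<^sub>C ?s (j # m)"
    using opj[OF j(3,2)] by (simp add: op_add op_cscale del: op_single cscale_single)
  finally have eq: "defect k (?s (j # m)) = op j X + op j (symbol k m x)
      + of_int (k - j) *\<^sub>C nf ((k + j) # m) x + cocycle k j *\<^sub>C ?s m"
    by (simp add: defect_def del: cscale_single)
  let ?F = "filtration (weight (j # m) - k)"
  have X: "op j X \<in> ?F"
    using op_filtration[OF j(1), of X "weight m - k"] Cons.IH[OF j(3) Cons.prems(2)]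
    by (simp add: X_def algebra_simps)
  have coc: "cocycle k j *\<^sub>C ?s m \<in> ?F"
    using j by (auto simp: cocycle_def simp del: cscale_single
        intro!: filtration_cscale filtration_single)
  have nfd: "nf (l # m) x = defect l (?s m) + \<chi> l *\<^sub>C ?s m" for l
    by (simp add: defect_def)
  show ?case
  proof (cases "k + j = 2")
    case True
    then have jk: "j = 2 - k" by simp
    let ?c = "Poly_Mapping.single m
        (2 * of_int (k - 1) * \<chi> 2 * of_nat (count_list m (2 - k)) * x)"
    have opS: "op j (symbol k m x) = Poly_Mapping.single m
        (2 * of_int (k - 1) * \<chi> 2 * of_nat (count_list m (2 - k)) * x)"
    proof (cases "j \<in> set m")
      case True
      then obtain m' where "m = j # m'"
        using j by (cases m) (fastforce simp: normal_Cons)+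
      then show ?thesis
        using opj[of m'] j by (simp add: symbol_def jk[symmetric] normal_Cons del: op_single)
    next
      case False
      then show ?thesis by (simp add: symbol_def jk count_list_0_iff op_zero del: op_single)
    qed
    have sym: "symbol k (j # m) x = Poly_Mapping.single m
        (2 * of_int (k - 1) * \<chi> 2 * of_nat (count_list m (2 - k)) * x)
        + (2 * of_int (k - 1)) *\<^sub>C \<chi> 2 *\<^sub>C ?s m"
      by (simp add: symbol_def jk single_add[symmetric] cscale_complex_def algebra_simps)
    have kj: "of_int (k - j) = 2 * (of_int (k - 1) :: complex)" by (simp add: jk)
    have "defect k (?s (j # m)) = op j X + ?c
        + (2 * of_int (k - 1)) *\<^sub>C (defect 2 (?s m) + \<chi> 2 *\<^sub>C ?s m) + cocycle k j *\<^sub>C ?s m"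
      unfolding eq opS True kj by (simp only: nfd)
    then have "defect k (?s (j # m)) - symbol k (j # m) x
        = op j X + (2 * of_int (k - 1)) *\<^sub>C defect 2 (?s m) + cocycle k j *\<^sub>C ?s m"
      unfolding sym cscale_add_right by simp
    moreover have "defect 2 (?s m) \<in> ?F"
      by (rule filtration_mono[OF coarse]) (use jk in auto)
    ultimately show ?thesis using X coc by (simp add: filtration_add filtration_cscale)
  next
    case False
    then have "op j (symbol k m x) = symbol k (j # m) x"
      using opj[OF normal_remove1[OF j(3)] rem] by (auto simp: symbol_def simp del: op_single)
    moreover have "nf ((k + j) # m) x \<in> ?F"
    proof (cases "k + j \<le> 0")
      case True
      then have "nf ((k + j) # m) x \<in> filtration (weight ((k + j) # m))"
        using j by (intro nf_filtration) (auto simp: normal_word_def)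
      then show ?thesis by (rule filtration_mono) simp
    next
      case pos: False
      have "\<chi> (k + j) *\<^sub>C ?s m \<in> ?F"
      proof (cases "k + j = 1")
        case True
        then show ?thesis using j by (intro filtration_cscale filtration_single) auto
      next
        case False
        with \<open>k + j \<noteq> 2\<close> pos have "\<chi> (k + j) = 0" by (intro chi_ge_3) simp
        then show ?thesis by simp
      qed
      moreover have "defect (k + j) (?s m) \<in> ?F"
        by (rule filtration_mono[OF coarse]) (use pos in auto)
      ultimately show ?thesis unfolding nfd by (intro filtration_add)
    qed
    ultimately show ?thesis using X coc unfolding eq
      by (simp add: filtration_add filtration_cscale)
  qed
qed


lemma lookup_defect:
  "Poly_Mapping.lookup (defect k p) u =
    (\<Sum>w\<in>Poly_Mapping.keys p.
      Poly_Mapping.lookup (defect k (Poly_Mapping.single w (Poly_Mapping.lookup p w))) u)"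
proof -
  have "defect k p = (\<Sum>w\<in>Poly_Mapping.keys p.
      defect k (Poly_Mapping.single w (Poly_Mapping.lookup p w)))"
    unfolding defect_sum[symmetric] sum_single_keys ..
  then show ?thesis by (simp add: lookup_sum)
qed

text \<open>
The letter \<open>j\<close> is deleted by \<open>d\<^sub>2\<^sub>-\<^sub>j\<close>. A sorted word is determined by what remains after the deletion of a given letter,
so the coefficient at that remainder cannot be cancelled by another word of top weight; words of
smaller weight do not reach it.
\<close>

lemma lookup_defect_top:
  assumes normal: "Poly_Mapping.keys p \<subseteq> {u. normal_word u}"
    and bound: "\<And>v. v \<in> Poly_Mapping.keys p \<Longrightarrow> weight v \<le> weight w"
    and w: "w \<in> Poly_Mapping.keys p" "j \<in> set w"
  shows "Poly_Mapping.lookup (defect (2 - j) p) (remove1 j w) =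
    2 * of_int (1 - j) * \<chi> 2 * of_nat (count_list w j) * Poly_Mapping.lookup p w"
proof -
  let ?u = "remove1 j w" and ?k = "2 - j" and ?p = "Poly_Mapping.lookup p"
  have nw: "normal_word w" and j: "j \<le> 0" using normal w by (auto simp: normal_word_def)
  have *: "Poly_Mapping.lookup (defect ?k (Poly_Mapping.single v (?p v))) ?u =
      (if v = w then 2 * of_int (1 - j) * \<chi> 2 * of_nat (count_list w j) * ?p w else 0)"
    if v: "v \<in> Poly_Mapping.keys p" for v
  proof -
    have nv: "normal_word v" using v normal by blast
    have "defect ?k (Poly_Mapping.single v (?p v)) - symbol ?k v (?p v) \<in> filtration (weight v - ?k)"
      using nv j by (intro defect_leading_term) auto
    moreover have "weight v - ?k < weight ?u"
      using bound[OF v] w by (simp add: weight_remove1)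
    ultimately have "Poly_Mapping.lookup
        (defect ?k (Poly_Mapping.single v (?p v)) - symbol ?k v (?p v)) ?u = 0"
      by (rule lookup_filtration)
    then have "Poly_Mapping.lookup (defect ?k (Poly_Mapping.single v (?p v))) ?u
        = Poly_Mapping.lookup (symbol ?k v (?p v)) ?u"
      by (simp add: lookup_minus)
    also have "\<dots> = (if v = w then 2 * of_int (1 - j) * \<chi> 2 * of_nat (count_list w j) * ?p w else 0)"
    proof (cases "j \<in> set v \<and> remove1 j v = ?u")
      case True
      then have "v = w"
        using nv nw w(2) insort_remove1 unfolding normal_word_def by metis
      then show ?thesis by (simp add: symbol_def lookup_single)
    next
      case False
      then have "v \<noteq> w" using w by auto
      moreover have "count_list v j = 0 \<or> remove1 j v \<noteq> ?u"
        using False by (auto simp: count_list_0_iff)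
      ultimately show ?thesis by (auto simp: symbol_def lookup_single when_def)
    qed
    finally show ?thesis .
  qed
  have "Poly_Mapping.lookup (defect ?k p) ?u = (\<Sum>v\<in>Poly_Mapping.keys p.
      if v = w then 2 * of_int (1 - j) * \<chi> 2 * of_nat (count_list w j) * ?p w else 0)"
    by (rule trans[OF lookup_defect sum.cong[OF refl *]])
  also have "\<dots> = 2 * of_int (1 - j) * \<chi> 2 * of_nat (count_list w j) * ?p w"
    using w by (simp add: sum.delta' sum.delta)
  finally show ?thesis .
qed

text \<open>
The hypothesis says that \<open>d\<^sub>j\<close> is the only word of top weight \<open>1 - j\<close>. As \<open>[d\<^sub>1, d\<^sub>j] = (1 - j) d\<^sub>j\<^sub>+\<^sub>1\<close> with
\<open>j + 1 \<le> 0\<close>, its image still contains a letter, whose weight the images of the lighter words do not reach.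
\<close>

lemma lookup_defect_1:
  assumes normal: "Poly_Mapping.keys p \<subseteq> {u. normal_word u}"
    and bound: "\<And>v. v \<in> Poly_Mapping.keys p \<Longrightarrow> v \<noteq> [j] \<Longrightarrow> weight v \<le> - j"
    and j: "j < 0" "[j] \<in> Poly_Mapping.keys p"
  shows "Poly_Mapping.lookup (defect 1 p) [j + 1] = of_int (1 - j) * Poly_Mapping.lookup p [j]"
proof -
  let ?p = "Poly_Mapping.lookup p"
  have *: "Poly_Mapping.lookup (defect 1 (Poly_Mapping.single v (?p v))) [j + 1] =
      (if v = [j] then of_int (1 - j) * ?p [j] else 0)" if v: "v \<in> Poly_Mapping.keys p" for v
  proof (cases "v = [j]")
    case True
    have nj: "normal_word [j]" "normal_word [j + 1]" using j by (auto simp: normal_word_def)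
    have "op 1 (Poly_Mapping.single [j] (?p [j])) = \<chi> 1 *\<^sub>C Poly_Mapping.single [j] (?p [j])
        + of_int (1 - j) *\<^sub>C Poly_Mapping.single [j + 1] (?p [j])"
      using nf_commute[of "[]" 1 j "[]" "?p [j]"] nf_last[of 1 "[j]" "?p [j]"] nj
      by (simp add: nf_normal cocycle_def cscale_complex_def add.commute)
    then have "defect 1 (Poly_Mapping.single [j] (?p [j]))
        = of_int (1 - j) *\<^sub>C Poly_Mapping.single [j + 1] (?p [j])"
      by (simp add: defect_def)
    then show ?thesis using True by (simp add: cscale_complex_def)
  next
    case False
    have "normal_word v" using v normal by blast
    then have "defect 1 (Poly_Mapping.single v (?p v)) \<in> filtration (weight v - 1)"
      using defect_leading_term[of v 1 "?p v"] by (simp add: symbol_def)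
    then show ?thesis using bound[OF v False] False by (simp add: lookup_filtration)
  qed
  have "Poly_Mapping.lookup (defect 1 p) [j + 1]
      = (\<Sum>v\<in>Poly_Mapping.keys p. if v = [j] then of_int (1 - j) * ?p [j] else 0)"
    by (rule trans[OF lookup_defect sum.cong[OF refl *]])
  then show ?thesis using j by (simp add: sum.delta' sum.delta)
qed

text \<open>
Let \<open>D\<close> be the top weight of \<open>p\<close> and suppose \<open>D \<ge> 2\<close>. A word of weight \<open>D\<close> with two or more letters would leave a
nonempty word with nonzero coefficient after the deletion of one letter, so the words of weight \<open>D\<close>
reduce to the single letter \<open>1 - D\<close>. Then \<open>d\<^sub>1\<close> yields the nonempty word \<open>2 - D\<close>, a contradiction.
\<close>

theorem scalar_defect_keys:
  assumes normal: "Poly_Mapping.keys p \<subseteq> {u. normal_word u}"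
    and scalar: "\<And>k. 0 < k \<Longrightarrow> \<exists>c. defect k p = Poly_Mapping.single [] c"
  shows "Poly_Mapping.keys p \<subseteq> {[], [0]}"
proof (rule ccontr)
  have vanish: "Poly_Mapping.lookup (defect k p) u = 0" if k: "0 < k" and u: "u \<noteq> []" for k u
  proof -
    obtain c where "defect k p = Poly_Mapping.single [] c" using scalar[OF k] by blast
    then show ?thesis using u by (simp add: lookup_single)
  qed
  let ?K = "Poly_Mapping.keys p"
  define D where "D = Max (weight ` ?K)"
  assume "\<not> ?K \<subseteq> {[], [0]}"
  then obtain v where v: "v \<in> ?K" "v \<noteq> []" "v \<noteq> [0]" by blast
  then have nv: "normal_word v" using normal by blast
  have le: "weight u \<le> D" if "u \<in> ?K" for u using that by (simp add: D_def)
  have "2 \<le> weight v"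
  proof (cases v)
    case (Cons j u)
    then show ?thesis
      using v nv weight_pos[of u] by (cases "u = []") (auto simp: normal_Cons)
  qed (use v in simp)
  then have "2 \<le> D" using le[OF v(1)] by simp
  have "D \<in> weight ` ?K" unfolding D_def using v by (intro Max_in) auto
  then obtain w where w: "w \<in> ?K" "weight w = D" by auto
  have single: "u = [1 - D]" if u: "u \<in> ?K" "weight u = D" for u
  proof (cases u)
    case Nil
    then show ?thesis using u \<open>2 \<le> D\<close> by simp
  next
    case (Cons j u')
    have "j \<le> 0" using u normal Cons by (auto simp: normal_Cons)
    have "Poly_Mapping.lookup (defect (2 - j) p) (remove1 j u) =
        2 * of_int (1 - j) * \<chi> 2 * of_nat (count_list u j) * Poly_Mapping.lookup p u"
      using u le Cons by (intro lookup_defect_top normal) auto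
    moreover have "\<dots> \<noteq> 0"
      using \<open>j \<le> 0\<close> Cons u chi_2 of_int_eq_0_iff[of "1 - j", where 'a = complex]
      by (auto simp: in_keys_iff simp del: of_int_diff of_int_eq_0_iff of_nat_Suc)
    ultimately have "u' = []" using vanish[of "2 - j" u'] \<open>j \<le> 0\<close> Cons by auto
    then show ?thesis using u Cons by simp
  qed
  from single[OF w] have top: "[1 - D] \<in> ?K" using w(1) by (simp only:)
  have "Poly_Mapping.lookup (defect 1 p) [1 - D + 1]
      = of_int (1 - (1 - D)) * Poly_Mapping.lookup p [1 - D]"
  proof (rule lookup_defect_1[OF normal _ _ top])
    fix u assume u: "u \<in> ?K" "u \<noteq> [1 - D]"
    have "weight u \<noteq> D" using single[OF u(1)] u(2) by metis
    then show "weight u \<le> - (1 - D)" using le[OF u(1)] by simp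
  qed (use \<open>2 \<le> D\<close> in simp)
  then show False using vanish[of 1 "[1 - D + 1]"] top \<open>2 \<le> D\<close> by (simp add: in_keys_iff)
qed

lemma defect_one: "0 < k \<Longrightarrow> defect k (Poly_Mapping.single [] x) = 0"
  using nf_last[of k "[]" x]
  by (simp add: defect_def nf_normal normal_word_def cscale_complex_def)

lemma defect_d0:
  assumes "0 < k"
  shows "defect k (Poly_Mapping.single [0] x) = Poly_Mapping.single [] (of_int k * \<chi> k * x)"
proof -
  have "nf [k, 0] x = \<chi> k *\<^sub>C Poly_Mapping.single [0] x + of_int k *\<^sub>C Poly_Mapping.single [] (\<chi> k * x)"
    using nf_commute[of "[]" k 0 "[]" x] nf_last[of k "[0]" x] nf_last[of k "[]" x] assms
    by (simp add: nf_normal normal_word_def cocycle_def cscale_complex_def)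
  then show ?thesis by (simp add: defect_def cscale_complex_def mult.assoc)
qed

corollary scalar_defect:
  assumes normal: "Poly_Mapping.keys p \<subseteq> {u. normal_word u}"
    and scalar: "\<And>k. 0 < k \<Longrightarrow> defect k p = Poly_Mapping.single [] (\<beta> k)"
  obtains a b where "p = Poly_Mapping.single [] a + Poly_Mapping.single [0] b"
    "\<And>k. 0 < k \<Longrightarrow> \<beta> k = b * (of_int k * \<chi> k)"
proof -
  define a b where "a = Poly_Mapping.lookup p []" and "b = Poly_Mapping.lookup p [0]"
  have "Poly_Mapping.keys p \<subseteq> {[], [0]}"
    using scalar_defect_keys[OF normal] scalar by blast
  then have p: "p = Poly_Mapping.single [] a + Poly_Mapping.single [0] b"
    unfolding a_def b_def
    by (intro poly_mapping_eqI) (auto simp: lookup_add lookup_single when_def in_keys_iff)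
  have "\<beta> k = b * (of_int k * \<chi> k)" if k: "0 < k" for k
  proof -
    have "\<beta> k = Poly_Mapping.lookup (defect k p) []"
      by (simp add: scalar[OF k])
    also have "\<dots> = b * (of_int k * \<chi> k)"
      by (simp add: p defect_add defect_one defect_d0 k)
    finally show ?thesis .
  qed
  with p show ?thesis by (rule that)
qed

end


section \<open>Morphisms of coefficient modules\<close>

text \<open>
The map \<open>f\<close> has to be compatible with the action only on the submodule \<open>S\<close>. This is the situation
for the coordinate along \<open>v\<^sub>j\<close>, which is a homomorphism from the span of \<open>v\<^sub>1, \<dots>, v\<^sub>j\<close> to \<open>\<complex>\<close> but
not from all of \<open>N\<close>; using \<open>S\<close> as a set avoids forming submodules and quotients as types.
\<close>

locale positive_module_hom =
  source: positive_module \<rho> \<xi> + target: positive_module \<rho>' \<xi>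
  for \<rho> :: "int \<Rightarrow> 'n::complex_vec \<Rightarrow> 'n" and \<rho>' :: "int \<Rightarrow> 'm::complex_vec \<Rightarrow> 'm" and \<xi> +
  fixes S :: "'n set" and f :: "'n \<Rightarrow> 'm"
  assumes f_add: "f (x + y) = f x + f y" and f_cscale: "f (c *\<^sub>C x) = c *\<^sub>C f x"
    and S_zero: "0 \<in> S" and S_add: "x \<in> S \<Longrightarrow> y \<in> S \<Longrightarrow> x + y \<in> S"
    and S_cscale: "x \<in> S \<Longrightarrow> c *\<^sub>C x \<in> S"
    and S_stable: "x \<in> S \<Longrightarrow> 0 < k \<Longrightarrow> \<rho> k x \<in> S"
    and f_hom: "x \<in> S \<Longrightarrow> 0 < k \<Longrightarrow> f (\<rho> k x) = \<rho>' k (f x)"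
begin

lemma f_zero: "f 0 = 0"
  using f_cscale[of 0 0] by simp

lemma lookup_map_f [simp]: "Poly_Mapping.lookup (Poly_Mapping.map f p) w = f (Poly_Mapping.lookup p w)"
  by (rule lookup_map_additive[of f, OF f_zero])

lemma map_f_add: "Poly_Mapping.map f (p + q) = Poly_Mapping.map f p + Poly_Mapping.map f q"
  by (intro poly_mapping_eqI) (simp add: lookup_add f_add)

lemma map_f_zero: "Poly_Mapping.map f 0 = 0"
  by (intro poly_mapping_eqI) (simp add: f_zero)

lemma map_f_cscale: "Poly_Mapping.map f (c *\<^sub>C p) = c *\<^sub>C Poly_Mapping.map f p"
  by (intro poly_mapping_eqI) (simp add: f_cscale)

lemma map_f_single: "Poly_Mapping.map f (Poly_Mapping.single w x) = Poly_Mapping.single w (f x)"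
  by (intro poly_mapping_eqI) (simp add: lookup_single when_def f_zero)

lemma map_f_diff: "Poly_Mapping.map f (p - q) = Poly_Mapping.map f p - Poly_Mapping.map f q"
  using map_f_add[of "p - q" q] by simp

lemma map_f_sum: "Poly_Mapping.map f (sum g T) = (\<Sum>i\<in>T. Poly_Mapping.map f (g i))"
  by (induction T rule: infinite_finite_induct) (simp_all add: map_f_add map_f_zero)

lemma keys_map_f: "Poly_Mapping.keys (Poly_Mapping.map f p) \<subseteq> Poly_Mapping.keys p"
  by (auto simp: in_keys_iff f_zero)

lemma map_f_nf: "x \<in> S \<Longrightarrow> Poly_Mapping.map f (source.nf w x) = target.nf w (f x)"
proof -
  have "x \<in> S \<longrightarrow> Poly_Mapping.map f (source.nf w x) = target.nf w (f x)"
  proof (rule source.nf_induct[of "\<lambda>w x p. x \<in> S \<longrightarrow> Poly_Mapping.map f p = target.nf w (f x)"])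
    fix w x assume "normal_word w"
    then show "x \<in> S \<longrightarrow> Poly_Mapping.map f (Poly_Mapping.single w x) = target.nf w (f x)"
      by (simp add: map_f_single target.nf_normal)
  next
    fix a k x p
    assume "0 < k" "\<rho> k x \<in> S \<longrightarrow> Poly_Mapping.map f p = target.nf a (f (\<rho> k x))"
    then show "x \<in> S \<longrightarrow> Poly_Mapping.map f p = target.nf (a @ [k]) (f x)"
      by (simp add: S_stable f_hom target.nf_last)
  next
    fix a k j b x p q r
    assume "x \<in> S \<longrightarrow> Poly_Mapping.map f p = target.nf (a @ j # k # b) (f x)"
      "x \<in> S \<longrightarrow> Poly_Mapping.map f q = target.nf (a @ (k + j) # b) (f x)"
      "x \<in> S \<longrightarrow> Poly_Mapping.map f r = target.nf (a @ b) (f x)"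
    then show "x \<in> S \<longrightarrow> Poly_Mapping.map f
        (p + of_int (k - j) *\<^sub>C q + source.cocycle k j *\<^sub>C r) = target.nf (a @ k # j # b) (f x)"
      using target.nf_commute[of a k j b "f x"] by (simp add: map_f_add map_f_cscale)
  qed
  then show "x \<in> S \<Longrightarrow> ?thesis" by blast
qed

lemma map_f_op:
  assumes "\<And>w. Poly_Mapping.lookup p w \<in> S"
  shows "Poly_Mapping.map f (source.op k p) = target.op k (Poly_Mapping.map f p)"
proof -
  have "Poly_Mapping.map f (source.op k p)
      = (\<Sum>w\<in>Poly_Mapping.keys p. target.nf (k # w) (f (Poly_Mapping.lookup p w)))"
    using assms by (simp add: source.op_def lift_sum_def map_f_sum map_f_nf)
  also have "\<dots> = target.op k (Poly_Mapping.map f p)"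
    unfolding target.op_def
    by (subst lift_sum_superset[OF target.nf_add, where S = "Poly_Mapping.keys p"])
      (auto simp: in_keys_iff f_zero)
  finally show ?thesis .
qed

end

lemma vir_d_nplus: "0 < k \<Longrightarrow> vir_d k \<in> nplus"
  unfolding nplus_def by (auto intro: cvec.span_base)

text \<open>
\<open>d\<^sub>k\<close> is a nonzero multiple of \<open>[d\<^sub>k\<^sub>-\<^sub>1, d\<^sub>1]\<close>.
\<close>

lemma nplus_hom_vanishes:
  assumes "nplus_hom \<psi>" "3 \<le> k"
  shows "\<psi> (vir_d k) = 0"
proof -
  have d: "vir_d (k - 1) \<in> nplus" "vir_d 1 \<in> nplus" "vir_d k \<in> nplus"
    using assms(2) by (auto intro: vir_d_nplus)
  have "bracket (vir_d (k - 1)) (vir_d 1) = of_int (k - 2) *\<^sub>C vir_d k"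
    using assms(2) by (simp add: vir_bracket_dd)
  then have "of_int (k - 2) * \<psi> (vir_d k) = 0"
    using assms d unfolding nplus_hom_def nplus_dual_def by metis
  then show ?thesis using assms(2) by (simp del: of_int_diff)
qed

lemma nplus_dual_eqI:
  assumes "nplus_dual f" "nplus_dual g" and eq: "\<And>k. 0 < k \<Longrightarrow> f (vir_d k) = c * g (vir_d k)"
    and "x \<in> nplus"
  shows "f x = c * g x"
proof -
  have lin: "h (a *\<^sub>C x + y) = a * h x + h y"
    if "nplus_dual h" "x \<in> nplus" "y \<in> nplus" for h a x y
  proof -
    have "a *\<^sub>C x \<in> nplus" using that(2) by (simp add: nplus_def cvec.span_scale)
    then show ?thesis using that by (simp add: nplus_dual_def)
  qed
  have "x \<in> nplus \<and> f x = c * g x"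
    using assms(4) unfolding nplus_def
  proof (induction x rule: cvec.span_induct_alt)
    case base
    have "0 \<in> nplus" by (simp add: nplus_def cvec.span_zero)
    then have "h 0 = 0" if "nplus_dual h" for h
      using lin[OF that, of 0 0 1] by simp
    from this[OF assms(1)] this[OF assms(2)] show ?case by (simp add: cvec.span_zero)
  next
    case (step a x y)
    have "x \<in> nplus" using step(1) by (auto intro: vir_d_nplus)
    moreover have "y \<in> nplus" "f y = c * g y" using step by (auto simp: nplus_def)
    moreover have "f x = c * g x" using step(1) eq by auto
    ultimately have "f (a *\<^sub>C x + y) = c * g (a *\<^sub>C x + y)"
      using assms(1,2) by (simp add: lin ring_distribs mult.left_commute)
    moreover have "a *\<^sub>C x + y \<in> nplus"
      using \<open>x \<in> nplus\<close> \<open>y \<in> nplus\<close> by (simp add: nplus_def cvec.span_add cvec.span_scale)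
    ultimately show ?case by (simp add: nplus_def)
  qed
  then show ?thesis ..
qed

section \<open>Whittaker vectors of the induced module\<close>

theorem theorem4p23:
  fixes \<psi> :: "virasoro \<Rightarrow> complex" and \<xi> :: complex and n :: nat
    and v :: "nat \<Rightarrow> 'n::zn_module" and \<alpha> :: "nat \<Rightarrow> nat \<Rightarrow> virasoro \<Rightarrow> complex"
  assumes psi_hom: "nplus_hom \<psi>"
    and psi_d2: "\<psi> (vir_d 2) \<noteq> 0"
    and z_act: "\<And>w :: 'n. zn_act (to_zn vir_z) w = \<xi> *\<^sub>C w"
    and n_pos: "1 \<le> n"
    and basis_inj: "inj_on v {1..n}"
    and basis_indep: "cvec.independent (v ` {1..n})"
    and basis_span: "cvec.span (v ` {1..n}) = UNIV"
    and alpha_dual: "\<And>i j. 1 \<le> i \<Longrightarrow> i < j \<Longrightarrow> j \<le> n \<Longrightarrow> nplus_dual (\<alpha> i j)"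
    and nplus_act: "\<And>x j. x \<in> nplus \<Longrightarrow> 1 \<le> j \<Longrightarrow> j \<le> n \<Longrightarrow>
      zn_act (to_zn x) (v j) = \<psi> x *\<^sub>C v j + (\<Sum>i\<in>{1..<j}. \<alpha> i j x *\<^sub>C v i)"
    and alpha_D: "\<And>i. 1 \<le> i \<Longrightarrow> i \<le> n - 1 \<Longrightarrow>
      \<not> (\<exists>c. \<forall>x\<in>nplus. \<alpha> i (i + 1) x = c * dfunctional \<psi> x)"
  shows "whittaker_vectors (ind_act :: virasoro \<Rightarrow> 'n induced \<Rightarrow> 'n induced) \<psi> =
    {c *\<^sub>C ind_tensor 1 (v 1) |c. True}"
proof
  show "{c *\<^sub>C ind_tensor 1 (v 1) |c. True} \<subseteq> whittaker_vectors ind_act \<psi>"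
  proof -
    have "ind_act x (c *\<^sub>C ind_tensor 1 (v 1)) = \<psi> x *\<^sub>C c *\<^sub>C ind_tensor 1 (v 1)"
      if x: "x \<in> nplus" for c x
    proof -
      have "zn_act (to_zn x) (v 1) = \<psi> x *\<^sub>C v 1"
        using nplus_act[of x 1] n_pos x by simp
      moreover have "of_zn (to_zn x) = x"
        using x nplus_subset_zn by (auto intro: of_zn_to_zn)
      ultimately have "ind_act x (ind_tensor 1 (v 1)) = \<psi> x *\<^sub>C ind_tensor 1 (v 1)"
        using ind_act_one_tensor[of "to_zn x" "v 1"] by (simp add: ind_tensor_cscale_right)
      then show ?thesis by (simp add: ind_module.act_cscale_right mult.commute)
    qed
    then show ?thesis unfolding whittaker_vectors_def by blast
  qed
next
  let ?\<chi> = "\<lambda>k. \<psi> (vir_d k)"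
  interpret N: positive_module "d_act :: int \<Rightarrow> 'n \<Rightarrow> 'n" \<xi>
    by (rule positive_module_d_act)
  interpret W: whittaker_character ?\<chi> \<xi>
    by unfold_locales (simp_all add: psi_d2 nplus_hom_vanishes[OF psi_hom])
  define B where "B = v ` {1..n}"
  have B: "cvec.independent B" "\<And>x. x \<in> cvec.span B" "finite B"
    using basis_indep basis_span by (simp_all add: B_def)
  define coord where "coord i x = cvec.representation B x (v i)" for i x
  have coord_add: "coord i (x + y) = coord i x + coord i y" for i x y
    by (simp add: coord_def cvec.representation_add B)
  have coord_cscale: "coord i (c *\<^sub>C x) = c * coord i x" for i c x
    by (simp add: coord_def cvec.representation_scale B)
  have coord_zero: "coord i 0 = 0" for i
    using coord_cscale[of i 0 0] by simp
  have coord_sum: "coord i (sum g T) = (\<Sum>t\<in>T. coord i (g t))" for i T and g :: "nat \<Rightarrow> 'n"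
    by (induction T rule: infinite_finite_induct) (simp_all add: coord_add coord_zero)
  have coord_basis: "coord i (v j) = (if i = j then 1 else 0)" if "i \<in> {1..n}" "j \<in> {1..n}" for i j
  proof -
    have "v j \<in> B" using that(2) unfolding B_def by (rule imageI)
    then show ?thesis
      using inj_on_eq_iff[OF basis_inj that] by (simp add: coord_def cvec.representation_basis B)
  qed
  have expand: "x = (\<Sum>i\<in>{1..n}. coord i x *\<^sub>C v i)" for x
  proof -
    have "x = (\<Sum>b\<in>B. cvec.representation B x b *\<^sub>C b)"
      by (rule cvec.sum_representation_eq[symmetric]) (simp_all add: B)
    then show ?thesis by (simp only: coord_def B_def sum.reindex[OF basis_inj] o_def)
  qed
  \<comment> \<open>\<open>S j\<close> is the span of \<open>v\<^sub>1, \<dots>, v\<^sub>j\<close>, described by vanishing coordinates.\<close>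
  define S where "S j = {x. \<forall>i\<in>{1..n}. j < i \<longrightarrow> coord i x = 0}" for j
  have act_basis: "d_act k (v j) = ?\<chi> k *\<^sub>C v j + (\<Sum>i\<in>{1..<j}. \<alpha> i j (vir_d k) *\<^sub>C v i)"
    if "0 < k" "j \<in> {1..n}" for k j
    using nplus_act[OF vir_d_nplus[OF that(1)]] that by (simp add: d_act_def)
  have coord_act_basis: "coord l (d_act k (v i)) = (if l = i then ?\<chi> k else 0)"
    if "0 < k" "i \<in> {1..n}" "l \<in> {1..n}" "i \<le> l" for k i l
    using that
    by (auto simp: act_basis coord_add coord_cscale coord_sum coord_basis intro!: sum.neutral)
  have coord_act: "coord l (d_act k x) = (if l = j then ?\<chi> k * coord j x else 0)"
    if "0 < k" "x \<in> S j" "j \<in> {1..n}" "l \<in> {1..n}" "j \<le> l" for k x j l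
  proof -
    have "d_act k (sum g T) = (\<Sum>t\<in>T. d_act k (g t))" for T and g :: "nat \<Rightarrow> 'n"
      using N.rho_cscale[of k 0 0]
      by (induction T rule: infinite_finite_induct) (simp_all add: N.rho_add)
    then have "d_act k x = (\<Sum>i\<in>{1..n}. coord i x *\<^sub>C d_act k (v i))"
      by (subst expand) (simp add: N.rho_cscale)
    then have "coord l (d_act k x) = (\<Sum>i\<in>{1..n}. coord i x * coord l (d_act k (v i)))"
      by (simp add: coord_sum coord_cscale)
    also have "\<dots> = (\<Sum>i\<in>{1..n}. if i = j then if l = j then ?\<chi> k * coord j x else 0 else 0)"
    proof (rule sum.cong[OF refl])
      fix i assume i: "i \<in> {1..n}"
      show "coord i x * coord l (d_act k (v i))
          = (if i = j then if l = j then ?\<chi> k * coord j x else 0 else 0)"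
      proof (cases "i \<le> j")
        case True
        then show ?thesis using coord_act_basis[of k i l] i that by auto
      next
        case False
        then have "coord i x = 0" using that(2) i by (simp add: S_def)
        then show ?thesis using False by simp
      qed
    qed
    also have "\<dots> = (if l = j then ?\<chi> k * coord j x else 0)"
      using that(3) by (simp add: sum.delta)
    finally show ?thesis .
  qed
  have hom: "positive_module_hom d_act (\<lambda>k x. ?\<chi> k * x) (S j) (coord j)" if j: "j \<in> {1..n}" for j
  proof unfold_locales
    fix x and k :: int assume x: "x \<in> S j" and k: "0 < k"
    show "d_act k x \<in> S j"
      unfolding S_def using coord_act[OF k x j] by auto
    show "coord j (d_act k x) = ?\<chi> k * coord j x"
      using coord_act[OF k x j j] by simp
  qed (auto simp: coord_add coord_cscale coord_zero S_def cscale_complex_def)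
  show "whittaker_vectors ind_act \<psi> \<subseteq> {c *\<^sub>C ind_tensor 1 (v 1) |c. True}"
  proof
    fix w :: "'n induced" assume "w \<in> whittaker_vectors ind_act \<psi>"
    then obtain p where p: "evaluate p = w" "Poly_Mapping.keys p \<subseteq> {u. normal_word u}"
      "\<And>k. 0 < k \<Longrightarrow> N.op k p = ?\<chi> k *\<^sub>C p"
      using whittaker_vector_representative[OF z_act] by blast
    let ?p = "Poly_Mapping.lookup p"
    \<comment> \<open>the indices of the basis vectors that occur in the Whittaker vector\<close>
    define J where "J = {i \<in> {1..n}. \<exists>u. coord i (?p u) \<noteq> 0}"
    show "w \<in> {c *\<^sub>C ind_tensor 1 (v 1) |c. True}"
    proof (cases "J = {}")
      case True
      have "?p u = 0" for u
        by (subst expand) (use True in \<open>auto simp: J_def intro!: sum.neutral\<close>)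
      then have "p = 0" by (intro poly_mapping_eqI) simp
      then have "w = 0 *\<^sub>C ind_tensor 1 (v 1)" using p(1) by (simp add: evaluate_zero)
      then show ?thesis by blast
    next
      case False
      define j where "j = Max J"
      have "finite J" by (simp add: J_def)
      then have "j \<in> J" unfolding j_def using False by (rule Max_in)
      then have j: "j \<in> {1..n}" and "\<exists>u. coord j (?p u) \<noteq> 0" by (simp_all add: J_def)
      then obtain u\<^sub>0 where u0: "coord j (?p u\<^sub>0) \<noteq> 0" by blast
      have "i \<le> j" if "i \<in> {1..n}" "coord i (?p u) \<noteq> 0" for i u
        unfolding j_def using that by (intro Max_ge \<open>finite J\<close>) (auto simp: J_def)
      then have pS: "?p u \<in> S j" for u
        unfolding S_def using linorder_not_less by blast
      interpret T: positive_module_hom d_act "\<lambda>k x. ?\<chi> k * x" \<xi> "S j" "coord j"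
        by (rule hom[OF j])
      define m where "m = Poly_Mapping.map (coord j) p"
      have keys_m: "Poly_Mapping.keys m \<subseteq> {u. normal_word u}"
        unfolding m_def using T.keys_map_f p(2) by (rule subset_trans)
      have defect_m: "W.defect k m = Poly_Mapping.single [] 0" if "0 < k" for k
        using T.map_f_op[OF pS, of k] p(3)[OF that]
        by (simp add: W.defect_def m_def T.map_f_cscale)
      obtain a b where m: "m = Poly_Mapping.single [] a + Poly_Mapping.single [0] b"
        and b: "\<And>k. 0 < k \<Longrightarrow> 0 = b * (of_int k * ?\<chi> k)"
        using W.scalar_defect[OF keys_m defect_m] by blast
      have "b = 0" using b[of 2] psi_d2 by simp
      have coord_p: "coord j (?p u) = (if u = [] then a else 0)" for u
        using m \<open>b = 0\<close> unfolding m_def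
        by (metis T.lookup_map_f add.right_neutral lookup_single_eq lookup_single_not_eq single_zero)
      have "a \<noteq> 0" using u0 by (simp add: coord_p split: if_splits)
      \<comment> \<open>Removing the constant top coordinate leaves coefficients in \<open>S (j - 1)\<close>.\<close>
      define q where "q = p - Poly_Mapping.single [] (a *\<^sub>C v j)"
      have coord_q: "coord i (Poly_Mapping.lookup q u) = 0" if "i \<in> {1..n}" "j \<le> i" for i u
      proof -
        have "coord i (Poly_Mapping.lookup q u + (if u = [] then a *\<^sub>C v j else 0)) = coord i (?p u)"
          by (simp add: q_def lookup_minus lookup_single)
        moreover have "coord i (?p u) = 0" if "j < i"
          using pS[of u] \<open>i \<in> {1..n}\<close> that by (simp add: S_def)
        ultimately show ?thesis
          using that coord_p[of u] coord_basis[OF that(1) j]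
          by (cases "i = j") (auto simp: coord_add coord_cscale coord_zero split: if_splits)
      qed
      show ?thesis
      proof (cases "j = 1")
        case True
        have "Poly_Mapping.lookup q u = 0" for u
          by (subst expand) (use coord_q True in \<open>auto intro!: sum.neutral\<close>)
        then have "q = 0" by (intro poly_mapping_eqI) simp
        then have "p = Poly_Mapping.single [] (a *\<^sub>C v 1)" using True by (simp add: q_def)
        then have "w = a *\<^sub>C ind_tensor 1 (v 1)"
          using p(1) by (simp add: word_vector_def ind_tensor_cscale_right)
        then show ?thesis by blast
      next
        case False
        define i where "i = j - 1"
        have ij: "i \<in> {1..n}" "j = i + 1" "i \<le> n - 1" using j False by (auto simp: i_def)
        have qS: "Poly_Mapping.lookup q u \<in> S i" for u
          using coord_q ij by (auto simp: S_def)
        interpret T': positive_module_hom d_act "\<lambda>k x. ?\<chi> k * x" \<xi> "S i" "coord i"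
          by (rule hom[OF ij(1)])
        define m' where "m' = Poly_Mapping.map (coord i) q"
        have "Poly_Mapping.keys q \<subseteq> {u. normal_word u}"
        proof
          fix u assume "u \<in> Poly_Mapping.keys q"
          then have "u \<in> Poly_Mapping.keys p \<or> u = []"
            by (cases "u = []") (auto simp: q_def in_keys_iff lookup_minus lookup_single)
          then show "u \<in> {u. normal_word u}" using p(2) by (auto simp: normal_word_def)
        qed
        with T'.keys_map_f have keys_m': "Poly_Mapping.keys m' \<subseteq> {u. normal_word u}"
          unfolding m'_def by (rule subset_trans)
        \<comment> \<open>The right-hand side comes from the term \<open>\<alpha> i j\<close> in the action on the removed \<open>a v\<^sub>j\<close>.\<close>
        have defect_m': "W.defect k m' = Poly_Mapping.single [] (- a * \<alpha> i j (vir_d k))" if k: "0 < k" for k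
        proof -
          have "N.op k q = ?\<chi> k *\<^sub>C p - Poly_Mapping.single [] (a *\<^sub>C d_act k (v j))"
            using N.nf_last[OF k, of "[]" "a *\<^sub>C v j"]
            by (simp add: q_def N.op_diff p(3)[OF k] N.nf_normal normal_word_def N.rho_cscale)
          also have "\<dots> = ?\<chi> k *\<^sub>C q
              - Poly_Mapping.single [] (a *\<^sub>C (\<Sum>l\<in>{1..<j}. \<alpha> l j (vir_d k) *\<^sub>C v l))"
            by (simp add: q_def act_basis[OF k j] cscale_add_right single_add
                cvec.scale_right_diff_distrib mult.commute)
          finally have "Poly_Mapping.map (coord i) (N.op k q) = ?\<chi> k *\<^sub>C m'
              - Poly_Mapping.single [] (a * (\<Sum>l\<in>{1..<j}. \<alpha> l j (vir_d k) * coord i (v l)))"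
            by (simp add: T'.map_f_diff T'.map_f_cscale T'.map_f_single m'_def
                coord_cscale coord_sum)
          also have "(\<Sum>l\<in>{1..<j}. \<alpha> l j (vir_d k) * coord i (v l))
              = (\<Sum>l\<in>{1..<j}. if l = i then \<alpha> i j (vir_d k) else 0)"
            by (rule sum.cong) (use ij j in \<open>auto simp: coord_basis\<close>)
          also have "\<dots> = \<alpha> i j (vir_d k)" using ij by (simp add: sum.delta)
          finally show ?thesis
            by (simp add: W.defect_def T'.map_f_op[OF qS] m'_def single_uminus)
        qed
        obtain b' where b': "\<And>k. 0 < k \<Longrightarrow> - a * \<alpha> i j (vir_d k) = b' * (of_int k * ?\<chi> k)"
          using W.scalar_defect[OF keys_m' defect_m'] by blast
        have "\<alpha> i j x = - b' / a * dfunctional \<psi> x" if "x \<in> nplus" for x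
        proof (rule nplus_dual_eqI[OF _ nplus_dual_dfunctional _ that])
          show "nplus_dual (\<alpha> i j)" using alpha_dual ij j by simp
          show "\<alpha> i j (vir_d k) = - b' / a * dfunctional \<psi> (vir_d k)" if "0 < k" for k
          proof -
            have "a * \<alpha> i j (vir_d k) = - (b' * (of_int k * ?\<chi> k))"
              by (simp flip: b'[OF that])
            then show ?thesis using \<open>a \<noteq> 0\<close> by (simp add: dfunctional_d field_simps)
          qed
        qed
        then have "\<exists>c. \<forall>x\<in>nplus. \<alpha> i (i + 1) x = c * dfunctional \<psi> x"
          unfolding ij(2) by blast
        then show ?thesis using alpha_D[of i] ij by simp
      qed
    qed
  qed
qed

end
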